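(* Let $b>1$ and suppose $m\in\{0,1,2,\dots\}$. The domain of $\Phi_b^{m+1}$ is $$\mathfrak{D}(\Phi_b^{m+1})=I_{\log^{m+1}}(\mathbb{R}^d).$$ Let $$f_m(u):=\int_0^u\binom{[v]+m}{m}\,dv,\qquad u\ge 0,$$ and let $f_m^*$ be its inverse function. Then $$\Phi_b^{m+1}(\mu)=\mathcal{L}\left(\int_0^\infty b^{-[f_m^*(t)]}\,dX_t^{(\mu)}\right)\qquad\text{for }\mu\in I_{\log^{m+1}}(\mathbb{R}^d).$$
   Context: $I(\mathbb{R}^d)$ is the class of all infinitely divisible distributions on $\mathbb{R}^d$; $\mathcal{L}(X)$ is the law of $X$; $[x]$ is the largest integer not greater than $x$; $\log^+|x|=(\log|x|)\vee 0$. For $k\in\mathbb{N}$, $I_{\log^k}(\mathbb{R}^d)=\{\mu\in I(\mathbb{R}^d):\int_{\mathbb{R}^d}(\log^+|x|)^k\,\mu(dx)<\infty\}$. For $\mu\in I(\mathbb{R}^d)$, $\{X_t^{(\mu)},t\ge 0\}$ denotes an $\mathbb{R}^d$-valued Lévy process with $\mathcal{L}(X_1^{(\mu)})=\mu$. For a nonrandom step function $f$ on $[0,\infty)$, $\int_0^t f(s)\,dX_s^{(\mu)}$ is the stochastic integral over $(0,t]$ (the finite sum of the values of $f$ times the increments of $X^{(\mu)}$ over the corresponding intervals), and $\int_0^\infty f(s)\,dX_s^{(\mu)}$ is the limit in probability of $\int_0^t f(s)\,dX_s^{(\mu)}$ as $t\to\infty$; it is called definable if this limit exists. For $b>1$,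 $$\Phi_b(\mu):=\mathcal{L}\left(\int_0^\infty b^{-[t]}\,dX_t^{(\mu)}\right),$$ with domain $\mathfrak{D}(\Phi_b)$ the set of $\mu\in I(\mathbb{R}^d)$ for which the integral is definable. $\Phi_b^{m}$ is the $m$-fold composition of $\Phi_b$ with itself, with $\mathfrak{D}(\Phi_b^{m+1})=\{\mu\in I(\mathbb{R}^d):\mu\in\mathfrak{D}(\Phi_b^m)\text{ and }\Phi_b^m(\mu)\in\mathfrak{D}(\Phi_b)\}$ for $m\ge1$. *)

theory Defs
  imports "HOL-Probability.Probability"
begin

section \<open>Infinitely divisible distributions\<close>

text \<open>The \<open>n\<close>-fold convolution; the empty convolution is the unit mass at \<open>0\<close>.\<close>

definition conv_power :: "nat \<Rightarrow> (real ^ 'd) measure \<Rightarrow> (real ^ 'd) measure" where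
  "conv_power n \<nu> = (convolution \<nu> ^^ n) (return borel 0)"

definition is_distribution :: "(real ^ 'd) measure \<Rightarrow> bool" where
  "is_distribution \<mu> \<longleftrightarrow> prob_space \<mu> \<and> sets \<mu> = sets borel"

definition inf_div :: "(real ^ 'd) measure set" where
  "inf_div = {\<mu>. is_distribution \<mu> \<and>
     (\<forall>n\<ge>1. \<exists>\<nu>. is_distribution \<nu> \<and> \<mu> = conv_power n \<nu>)}"

text \<open>Since \<^term>\<open>ln 0 = (0::real)\<close>, the integrand is \<open>0\<close> at the origin, as it should be.\<close>

definition inf_div_log :: "nat \<Rightarrow> (real ^ 'd) measure set" where
  "inf_div_log k = {\<mu> \<in> inf_div. (\<integral>\<^sup>+x. ennreal ((max (ln (norm x)) 0) ^ k) \<partial>\<mu>) < \<infinity>}"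


section \<open>Levy processes\<close>

text \<open>The index set is the half-line; values of \<open>X\<close> at negative times are irrelevant.\<close>

locale levy_process = prob_space M for M :: "'w measure" +
  fixes X :: "real \<Rightarrow> 'w \<Rightarrow> real ^ 'd"
  assumes measurable_X: "\<And>t. 0 \<le> t \<Longrightarrow> X t \<in> borel_measurable M"
    and start_zero: "AE \<omega> in M. X 0 \<omega> = 0"
    and indep_increments: "\<And>n \<tau>. 0 \<le> \<tau> 0 \<Longrightarrow> (\<And>i. i < n \<Longrightarrow> \<tau> i < \<tau> (Suc i)) \<Longrightarrow>
      indep_vars (\<lambda>_. borel) (\<lambda>i \<omega>. X (\<tau> (Suc i)) \<omega> - X (\<tau> i) \<omega>) {..<n::nat}"
    and stationary_increments: "\<And>s t. 0 \<le> s \<Longrightarrow> 0 \<le> t \<Longrightarrow>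
      distr M borel (\<lambda>\<omega>. X (s + t) \<omega> - X s \<omega>) = distr M borel (\<lambda>\<omega>. X t \<omega> - X 0 \<omega>)"
    and stoch_continuous: "\<And>t \<epsilon>. 0 \<le> t \<Longrightarrow> 0 < \<epsilon> \<Longrightarrow>
      ((\<lambda>s. prob {\<omega> \<in> space M. dist (X s \<omega>) (X t \<omega>) > \<epsilon>}) \<longlongrightarrow> 0) (at t within {0..})"
    and cadlag: "AE \<omega> in M. \<forall>t\<ge>0. ((\<lambda>s. X s \<omega>) \<longlongrightarrow> X t \<omega>) (at_right t) \<and>
      (t > 0 \<longrightarrow> (\<exists>l. ((\<lambda>s. X s \<omega>) \<longlongrightarrow> l) (at_left t)))"

text \<open>The notation \<open>X\<^sup>(\<^sup>\<mu>\<^sup>)\<close>: to every infinitely divisible \<open>\<mu>\<close> a Levy process \<open>X \<mu>\<close>, living on a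
  probability space \<open>P \<mu>\<close>, with law \<open>\<mu>\<close> at time \<open>1\<close>. Such families exist by the classical
  correspondence between infinitely divisible distributions and Levy processes. The family is a
  parameter of what follows; domains and laws of integrals do not depend on its choice.\<close>

definition levy_family ::
  "((real ^ 'd) measure \<Rightarrow> 'w measure) \<Rightarrow> ((real ^ 'd) measure \<Rightarrow> real \<Rightarrow> 'w \<Rightarrow> real ^ 'd) \<Rightarrow> bool" where
  "levy_family P X \<longleftrightarrow>
     (\<forall>\<mu>\<in>inf_div. levy_process (P \<mu>) (X \<mu>) \<and> distr (P \<mu>) borel (X \<mu> 1) = \<mu>)"


section \<open>Stochastic integrals of nonrandom step functions\<close>

text \<open>A partition \<open>0 = \<tau> 0 < \<dots> < \<tau> n = t\<close> such that \<open>f\<close> is constant on each open subinterval.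
  Values at the partition points are disregarded, so that functions constant on intervals
  \<open>[a, c)\<close> and on intervals \<open>(a, c]\<close> are treated alike.\<close>

definition step_partition :: "(real \<Rightarrow> real) \<Rightarrow> real \<Rightarrow> nat \<Rightarrow> (nat \<Rightarrow> real) \<Rightarrow> bool" where
  "step_partition f t n \<tau> \<longleftrightarrow> \<tau> 0 = 0 \<and> \<tau> n = t \<and> (\<forall>i<n. \<tau> i < \<tau> (Suc i)) \<and>
     (\<forall>i<n. f constant_on {\<tau> i<..<\<tau> (Suc i)})"

definition step_function :: "(real \<Rightarrow> real) \<Rightarrow> bool" where
  "step_function f \<longleftrightarrow> (\<forall>t\<ge>0. \<exists>n \<tau>. step_partition f t n \<tau>)"

text \<open>The value of \<open>f\<close> on a subinterval is read off at its midpoint. The sum does not depend on the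
  partition, since passing to a refinement does not change it.\<close>

definition step_integral ::
  "(real \<Rightarrow> 'w \<Rightarrow> real ^ 'd) \<Rightarrow> (real \<Rightarrow> real) \<Rightarrow> real \<Rightarrow> 'w \<Rightarrow> real ^ 'd" where
  "step_integral X f t \<omega> =
     (let (n, \<tau>) = (SOME (n, \<tau>). step_partition f t n \<tau>)
      in \<Sum>i<n. f ((\<tau> i + \<tau> (Suc i)) / 2) *\<^sub>R (X (\<tau> (Suc i)) \<omega> - X (\<tau> i) \<omega>))"

definition tendsto_in_prob ::
  "'w measure \<Rightarrow> ('i \<Rightarrow> 'w \<Rightarrow> real ^ 'd) \<Rightarrow> ('w \<Rightarrow> real ^ 'd) \<Rightarrow> 'i filter \<Rightarrow> bool" where
  "tendsto_in_prob M Z Y F \<longleftrightarrow> Y \<in> borel_measurable M \<and>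
     (\<forall>\<epsilon>>0. ((\<lambda>t. measure M {\<omega> \<in> space M. dist (Z t \<omega>) (Y \<omega>) > \<epsilon>}) \<longlongrightarrow> 0) F)"

definition definable ::
  "'w measure \<Rightarrow> (real \<Rightarrow> 'w \<Rightarrow> real ^ 'd) \<Rightarrow> (real \<Rightarrow> real) \<Rightarrow> bool" where
  "definable M X f \<longleftrightarrow> step_function f \<and> (\<exists>Y. tendsto_in_prob M (step_integral X f) Y at_top)"

text \<open>The integral over the half-line; limits in probability are unique almost surely, so its law is
  determined.\<close>

definition improper_integral ::
  "'w measure \<Rightarrow> (real \<Rightarrow> 'w \<Rightarrow> real ^ 'd) \<Rightarrow> (real \<Rightarrow> real) \<Rightarrow> 'w \<Rightarrow> real ^ 'd" where
  "improper_integral M X f = (SOME Y. tendsto_in_prob M (step_integral X f) Y at_top)"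

definition integral_law ::
  "'w measure \<Rightarrow> (real \<Rightarrow> 'w \<Rightarrow> real ^ 'd) \<Rightarrow> (real \<Rightarrow> real) \<Rightarrow> (real ^ 'd) measure" where
  "integral_law M X f = distr M borel (improper_integral M X f)"


section \<open>The mapping \<open>\<Phi>\<^sub>b\<close> and its iterates\<close>

definition Phi_dom ::
  "((real ^ 'd) measure \<Rightarrow> 'w measure) \<Rightarrow> ((real ^ 'd) measure \<Rightarrow> real \<Rightarrow> 'w \<Rightarrow> real ^ 'd) \<Rightarrow>
   real \<Rightarrow> (real ^ 'd) measure set" where
  "Phi_dom P X b = {\<mu> \<in> inf_div. definable (P \<mu>) (X \<mu>) (\<lambda>t. b powi (- \<lfloor>t\<rfloor>))}"

definition Phi ::
  "((real ^ 'd) measure \<Rightarrow> 'w measure) \<Rightarrow> ((real ^ 'd) measure \<Rightarrow> real \<Rightarrow> 'w \<Rightarrow> real ^ 'd) \<Rightarrow>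
   real \<Rightarrow> (real ^ 'd) measure \<Rightarrow> (real ^ 'd) measure" where
  "Phi P X b \<mu> = integral_law (P \<mu>) (X \<mu>) (\<lambda>t. b powi (- \<lfloor>t\<rfloor>))"

text \<open>The iterate \<open>\<Phi>\<^sub>b\<^sup>m\<close> is \<^term>\<open>Phi P X b ^^ m\<close> on the following domain; \<open>\<Phi>\<^sub>b\<^sup>0\<close> is the
  identity on all infinitely divisible distributions, which makes the first iterate \<open>\<Phi>\<^sub>b\<close> itself.\<close>

primrec Phi_pow_dom ::
  "((real ^ 'd) measure \<Rightarrow> 'w measure) \<Rightarrow> ((real ^ 'd) measure \<Rightarrow> real \<Rightarrow> 'w \<Rightarrow> real ^ 'd) \<Rightarrow>
   real \<Rightarrow> nat \<Rightarrow> (real ^ 'd) measure set" where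
  "Phi_pow_dom P X b 0 = inf_div"
| "Phi_pow_dom P X b (Suc m) =
     {\<mu> \<in> inf_div. \<mu> \<in> Phi_pow_dom P X b m \<and> (Phi P X b ^^ m) \<mu> \<in> Phi_dom P X b}"


section \<open>The time change\<close>

definition f_m :: "nat \<Rightarrow> real \<Rightarrow> real" where
  "f_m m u = integral {0..u} (\<lambda>v. real ((nat \<lfloor>v\<rfloor> + m) choose m))"

definition f_m_inv :: "nat \<Rightarrow> real \<Rightarrow> real" where
  "f_m_inv m = the_inv_into {0..} (f_m m)"

end

theory Submission
  imports Defs
begin

text \<open>
  The increments of the Levy process over unit intervals are independent with law \<open>\<mu>\<close>, so
  \<open>\<Phi>\<^sub>b(\<mu>)\<close> is the law of \<open>\<Sum>\<^sub>j b\<^sup>-\<^sup>j \<xi>\<^sub>j\<close> with independent \<open>\<xi>\<^sub>j\<close> of law \<open>\<mu>\<close>. In the monoid of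
  distributions under convolution it is the unique solution \<open>\<rho>\<close> of \<open>\<rho> = \<mu> + b\<^sup>-\<^sup>1 \<rho>\<close>. For such a pair,
  \<open>\<rho>\<close> has a finite \<open>k\<close>-th logarithmic moment iff \<open>\<mu>\<close> has a finite \<open>(k+1)\<close>-st one: one direction is
  a pathwise bound for the series, the other one iterates a lower bound for the tail of
  \<open>\<mu> + b\<^sup>-\<^sup>1 \<rho>\<close> along a geometric sequence. This determines the domains of the iterates. Applying the
  fixed point equation to the summands of a partial sum for \<open>\<Phi>\<^sub>b(\<mu>)\<close> and using Pascal's rule shows by
  induction that \<open>\<Phi>\<^sub>b\<close> iterated \<open>m + 1\<close> times yields the limit law of the sums, over \<open>j < n\<close>, of
  \<open>j + m choose m\<close> independent copies of \<open>\<mu>\<close> at scale \<open>b\<^sup>-\<^sup>j\<close>. These are the partial integrals of the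
  time-changed integrand, because the integer part of the inverse of \<open>f\<^sub>m\<close> equals \<open>j\<close> on an interval
  of length \<open>j + m choose m\<close>.
\<close>

section \<open>The convolution monoid of Borel distributions\<close>

text \<open>Successive iterates of the mapping are integrals on unrelated probability spaces, so
  they can be compared only through laws. Making the Borel distributions a type of class
  \<open>comm_monoid_add\<close> turns rearrangements of independent sums into algebra. Convolution
  is not cancellative in general, so uniqueness of the fixed point comes from contraction: the
  remainder \<open>lscale ((1 / b) ^ n) \<rho>\<close> vanishes in probability. The delicate
  direction is the necessity of the moment. Definability only yields a limit law, that is, a fixed
  point without any known moment; the tail iteration, started with the trivial moment of order 0,
  must extract order 1 from the mere existence of that fixed point. Numbers of copies grow
  polynomially while scales decay geometrically; the upper estimates split \<open>b\<close> as
  \<open>sqrt b * sqrt b\<close>, one factor serving the tails and the other absorbing the numbers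
  of copies. Finally, definability concerns all real times, not only block ends, so increments
  inside blocks of growing length must be controlled uniformly.\<close>

typedef (overloaded) 'a law = "{\<mu> :: 'a::ordered_euclidean_space measure. prob_space \<mu> \<and> sets \<mu> = sets borel}"
  morphisms meas Law
  by (auto intro!: exI[of _ "return borel 0"] prob_space_return)

lemma prob_space_meas [simp, intro]: "prob_space (meas A)"
  and sets_meas [simp, measurable_cong]: "sets (meas A) = sets borel"
  using meas[of A] by auto

lemma space_meas [simp]: "space (meas A) = UNIV"
  using sets_eq_imp_space_eq[OF sets_meas] by simp

lemma finite_measure_meas [simp, intro]: "finite_measure (meas A)"
  using prob_space_meas prob_space_def by blast

lemma meas_Law: "prob_space \<mu> \<Longrightarrow> sets \<mu> = sets borel \<Longrightarrow> meas (Law \<mu>) = \<mu>"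
  by (simp add: Law_inverse)

lemma law_eqI:
  assumes "\<And>f. f \<in> borel_measurable borel \<Longrightarrow> (\<integral>\<^sup>+x. f x \<partial>meas A) = (\<integral>\<^sup>+x. f x \<partial>meas B)"
  shows "A = B"
proof -
  have "meas A = meas B"
  proof (rule measure_eqI)
    fix S assume "S \<in> sets (meas A)"
    then show "emeasure (meas A) S = emeasure (meas B) S"
      using assms[of "indicator S"] by simp
  qed simp
  then show ?thesis by (simp add: meas_inject)
qed

text \<open>Tagged \<open>measurable\<close> so that inner integrals of iterated convolution
  integrals are handled automatically; \<open>borel\<close> may stand for \<open>meas A\<close> in
  the product because both have the same sets.\<close>

lemma borel_measurable_nn_integral_meas [measurable]:
  "(\<lambda>(x, y). f x y) \<in> borel_measurable (N \<Otimes>\<^sub>M borel) \<Longrightarrow>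
    (\<lambda>x. \<integral>\<^sup>+y. f x y \<partial>meas A) \<in> borel_measurable N"
  by (rule sigma_finite_measure.borel_measurable_nn_integral)
    (simp_all add: finite_measure.sigma_finite_measure cong: measurable_cong_sets)

definition law :: "'w measure \<Rightarrow> ('w \<Rightarrow> 'a::ordered_euclidean_space) \<Rightarrow> 'a law" where
  "law M V = Law (distr M borel V)"

lemma (in prob_space) meas_law: "V \<in> borel_measurable M \<Longrightarrow> meas (law M V) = distr M borel V"
  by (simp add: law_def meas_Law prob_space_distr)

lemma (in prob_space) nn_integral_law:
  assumes "V \<in> borel_measurable M" "f \<in> borel_measurable borel"
  shows "(\<integral>\<^sup>+x. f x \<partial>meas (law M V)) = (\<integral>\<^sup>+\<omega>. f (V \<omega>) \<partial>M)"
  using assms by (simp add: meas_law nn_integral_distr)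

instantiation law :: (ordered_euclidean_space) comm_monoid_add
begin

definition zero_law :: "'a law" where "zero_law = Law (return borel 0)"

definition plus_law :: "'a law \<Rightarrow> 'a law \<Rightarrow> 'a law" where
  "plus_law A B = Law (meas A \<star> meas B)"

lemma meas_zero: "meas (0 :: 'a law) = return borel 0"
  by (simp add: zero_law_def meas_Law prob_space_return)

lemma meas_plus: "meas (A + B :: 'a law) = (meas A \<star> meas B)"
proof -
  interpret A: prob_space "meas A" by simp
  interpret B: prob_space "meas B" by simp
  interpret AB: pair_prob_space "meas A" "meas B" ..
  have "prob_space (meas A \<star> meas B)"
    unfolding convolution_def by (rule AB.prob_space_distr) simp
  then show ?thesis by (simp add: plus_law_def meas_Law)
qed

lemma nn_integral_zero_law:
  "f \<in> borel_measurable borel \<Longrightarrow> (\<integral>\<^sup>+x. f x \<partial>meas (0 :: 'a law)) = f 0"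
  by (simp add: meas_zero nn_integral_return)

lemma nn_integral_plus_law:
  "f \<in> borel_measurable borel \<Longrightarrow>
    (\<integral>\<^sup>+x. f x \<partial>meas (A + B :: 'a law)) = (\<integral>\<^sup>+x. \<integral>\<^sup>+y. f (x + y) \<partial>meas B \<partial>meas A)"
  by (simp add: meas_plus nn_integral_convolution)

instance
proof
  fix A B C :: "'a law"
  show "A + B + C = A + (B + C)"
    by (simp add: meas_inject[symmetric] meas_plus convolution_associative)
  show "A + B = B + A"
    by (simp add: meas_inject[symmetric] meas_plus convolution_commutative)
  show "0 + A = A"
    by (rule law_eqI) (simp add: nn_integral_plus_law nn_integral_zero_law)
qed

end

section \<open>Convolution powers, scalings and laws of random variables\<close>

primrec nmul :: "nat \<Rightarrow> 'a::ordered_euclidean_space law \<Rightarrow> 'a law" where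
  "nmul 0 A = 0"
| "nmul (Suc n) A = A + nmul n A"

lemma nmul_add: "nmul (n + k) A = nmul n A + nmul k A"
  by (induction n) (simp_all add: add.assoc)

lemma nmul_plus: "nmul n (A + B) = nmul n A + nmul n B"
  by (induction n) (simp_all add: ac_simps)

definition lscale :: "real \<Rightarrow> 'a::ordered_euclidean_space law \<Rightarrow> 'a law" where
  "lscale c A = law (meas A) (\<lambda>x. c *\<^sub>R x)"

lemma nn_integral_lscale:
  "f \<in> borel_measurable borel \<Longrightarrow>
    (\<integral>\<^sup>+x. f x \<partial>meas (lscale c A)) = (\<integral>\<^sup>+x. f (c *\<^sub>R x) \<partial>meas A)"
  unfolding lscale_def by (rule prob_space.nn_integral_law) simp_all

lemma lscale_zero [simp]: "lscale c 0 = 0"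
  by (rule law_eqI) (simp add: nn_integral_lscale nn_integral_zero_law)

lemma lscale_one [simp]: "lscale 1 A = A"
  by (rule law_eqI) (simp add: nn_integral_lscale)

lemma lscale_lscale: "lscale c (lscale d A) = lscale (c * d) A"
  by (rule law_eqI) (simp add: nn_integral_lscale)

lemma lscale_plus: "lscale c (A + B) = lscale c A + lscale c B"
  by (rule law_eqI) (simp add: nn_integral_lscale nn_integral_plus_law scaleR_add_right)

lemma lscale_nmul: "lscale c (nmul n A) = nmul n (lscale c A)"
  by (induction n) (simp_all add: lscale_plus)

lemma lscale_sum: "lscale c (\<Sum>i\<in>I. f i) = (\<Sum>i\<in>I. lscale c (f i))"
  by (induction I rule: infinite_finite_induct) (simp_all add: lscale_plus)

lemma (in prob_space) law_lscale:
  "V \<in> borel_measurable M \<Longrightarrow> law M (\<lambda>\<omega>. c *\<^sub>R V \<omega>) = lscale c (law M V)"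
  by (rule law_eqI) (simp add: nn_integral_lscale nn_integral_law)

lemma (in prob_space) law_add:
  assumes "indep_var borel V borel W"
  shows "law M (\<lambda>\<omega>. V \<omega> + W \<omega>) = law M V + law M W"
proof -
  have [measurable]: "V \<in> borel_measurable M" "W \<in> borel_measurable M"
    using assms indep_var_rv1 indep_var_rv2 by blast+
  then show ?thesis
    by (simp add: meas_inject[symmetric] meas_plus meas_law sum_indep_random_variable[OF assms])
qed

lemma (in prob_space) law_sum:
  fixes V :: "'i \<Rightarrow> 'a \<Rightarrow> 'b::ordered_euclidean_space"
  assumes "finite I" "indep_vars (\<lambda>_. borel) V I"
  shows "law M (\<lambda>\<omega>. \<Sum>i\<in>I. V i \<omega>) = (\<Sum>i\<in>I. law M (V i))"
  using assms
proof (induction I)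
  case empty
  show ?case
    by (rule law_eqI) (simp add: nn_integral_law nn_integral_zero_law emeasure_space_1)
next
  case (insert i I)
  \<comment> \<open>Independence over the disjoint index sets \<open>{i}\<close> and
    \<open>I\<close>, composed with a projection and a finite sum, gives the pair that
    \<open>law_add\<close> requires.\<close>
  have "indep_var
    borel ((\<lambda>f. f i) \<circ> (\<lambda>\<omega>. restrict (\<lambda>i. V i \<omega>) {i}))
    borel ((\<lambda>f. \<Sum>i\<in>I. f i) \<circ> (\<lambda>\<omega>. restrict (\<lambda>i. V i \<omega>) I))"
    using insert.hyps by (intro indep_var_compose[OF indep_var_restrict[OF insert.prems]]) auto
  also have "((\<lambda>f. f i) \<circ> (\<lambda>\<omega>. restrict (\<lambda>i. V i \<omega>) {i})) = V i" by auto
  also have "((\<lambda>f. \<Sum>i\<in>I. f i) \<circ> (\<lambda>\<omega>. restrict (\<lambda>i. V i \<omega>) I)) = (\<lambda>\<omega>. \<Sum>i\<in>I. V i \<omega>)"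
    by (auto cong: rev_conj_cong)
  finally have "law M (\<lambda>\<omega>. V i \<omega> + (\<Sum>i\<in>I. V i \<omega>)) = law M (V i) + law M (\<lambda>\<omega>. \<Sum>i\<in>I. V i \<omega>)"
    by (rule law_add)
  moreover have "indep_vars (\<lambda>_. borel) V I"
    using insert.prems by (rule indep_vars_subset) auto
  ultimately show ?case using insert by simp
qed

section \<open>Tails of laws\<close>

definition tail :: "'a::ordered_euclidean_space law \<Rightarrow> real \<Rightarrow> real" where
  "tail A x = measure (meas A) {y. x < norm y}"

lemma tail_nonneg [simp]: "0 \<le> tail A x"
  by (simp add: tail_def)

lemma tail_le_1 [simp]: "tail A x \<le> 1"
  unfolding tail_def by (rule prob_space.prob_le_1) simp

lemma tail_antimono: "x \<le> y \<Longrightarrow> tail A y \<le> tail A x"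
  unfolding tail_def by (intro finite_measure.finite_measure_mono) auto

lemma emeasure_tail: "emeasure (meas A) {y. x < norm y} = ennreal (tail A x)"
  unfolding tail_def by (rule finite_measure.emeasure_eq_measure) simp

lemma (in prob_space) tail_law:
  assumes "V \<in> borel_measurable M"
  shows "tail (law M V) x = prob {\<omega> \<in> space M. x < norm (V \<omega>)}"
  using assms unfolding tail_def meas_law[OF assms]
  by (subst measure_distr) (auto intro!: arg_cong[where f = prob])

lemma tail_lscale: "0 < c \<Longrightarrow> tail (lscale c A) x = tail A (x / c)"
  unfolding lscale_def
  by (subst prob_space.tail_law) (simp_all add: tail_def divide_less_eq mult.commute)

lemma tail_zero: "0 \<le> x \<Longrightarrow> tail 0 x = 0"
  unfolding tail_def meas_zero by (subst measure_return) (auto simp: indicator_def)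

text \<open>A union bound: if the sum exceeds the joint threshold, one of the summands exceeds its
  share.\<close>

lemma tail_plus: "tail (A + B) (x + y) \<le> tail A x + tail B y"
proof -
  have "emeasure (meas (A + B)) {z. x + y < norm z} =
      (\<integral>\<^sup>+z. indicator {z. x + y < norm z} z \<partial>meas (A + B))"
    by simp
  also have "\<dots> = (\<integral>\<^sup>+u. \<integral>\<^sup>+v. indicator {z. x + y < norm z} (u + v) \<partial>meas B \<partial>meas A)"
    by (rule nn_integral_plus_law) simp
  also have "\<dots> \<le> (\<integral>\<^sup>+u. \<integral>\<^sup>+v. indicator {z. x < norm z} u + indicator {z. y < norm z} v \<partial>meas B \<partial>meas A)"
  proof (intro nn_integral_mono)
    fix u v :: 'a
    show "indicator {z. x + y < norm z} (u + v) \<le>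
        (indicator {z. x < norm z} u + indicator {z. y < norm z} v :: ennreal)"
      using norm_triangle_ineq[of u v] by (auto simp: indicator_def)
  qed
  also have "\<dots> = emeasure (meas A) {z. x < norm z} + emeasure (meas B) {z. y < norm z}"
    by (simp add: nn_integral_add prob_space.emeasure_space_1[OF prob_space_meas, simplified])
  finally show ?thesis
    by (simp add: emeasure_tail ennreal_plus[symmetric] del: ennreal_plus)
qed

text \<open>The threshold is shared equally among the summands. The loss of a factor
  \<open>n\<close> on both sides is harmless later, where \<open>n\<close> is polynomial and the
  threshold geometric in the index.\<close>

lemma tail_nmul: "tail (nmul n A) (real n * x) \<le> real n * tail A x"
proof (induction n)
  case (Suc n)
  have "tail (nmul (Suc n) A) (x + real n * x) \<le> tail A x + real n * tail A x"
    using tail_plus[of A "nmul n A" x "real n * x"] Suc by simp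
  then show ?case by (simp add: algebra_simps)
qed (simp add: tail_zero)

lemma tail_tendsto_0: "(tail A \<longlongrightarrow> 0) at_top"
proof (rule decreasing_tendsto)
  show "\<forall>\<^sub>F n in at_top. 0 \<le> tail A n" by simp
  fix e :: real assume "0 < e"
  interpret prob_space "meas A" by simp
  have "(\<lambda>n. prob {y. real n < norm y}) \<longlonglongrightarrow> prob (\<Inter>n. {y. real n < norm y})"
    by (rule finite_Lim_measure_decseq) (auto simp: decseq_def)
  moreover have "(\<Inter>n. {y :: 'a. real n < norm y}) = {}"
  proof (intro equals0I)
    fix x :: 'a assume x: "x \<in> (\<Inter>n. {y. real n < norm y})"
    obtain n where "norm x < real n" using reals_Archimedean2 by blast
    moreover have "real n < norm x" using x by blast
    ultimately show False by simp
  qed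
  ultimately have "(\<lambda>n. tail A (real n)) \<longlonglongrightarrow> 0" by (simp add: tail_def)
  then have "\<forall>\<^sub>F n in sequentially. tail A (real n) < e"
    using \<open>0 < e\<close> by (rule order_tendstoD)
  then obtain n where "tail A (real n) < e"
    by (auto simp: eventually_sequentially)
  then show "\<forall>\<^sub>F x in at_top. tail A x < e"
    using tail_antimono[of "real n" _ A]
    by (intro eventually_mono[OF eventually_ge_at_top[of "real n"]]) (rule le_less_trans)
qed

lemma tail_filterlim:
  "filterlim g at_top F \<Longrightarrow> ((\<lambda>n. tail A (g n)) \<longlongrightarrow> 0) F"
  by (rule filterlim_compose[OF tail_tendsto_0])

section \<open>Weak convergence\<close>

text \<open>Lipschitz test functions suffice to determine the limit and are stable under perturbations
  that are small in probability.\<close>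

definition law_tendsto :: "(nat \<Rightarrow> 'a::ordered_euclidean_space law) \<Rightarrow> 'a law \<Rightarrow> bool" where
  "law_tendsto T \<rho> \<longleftrightarrow> (\<forall>g :: 'a \<Rightarrow> real. bounded (range g) \<longrightarrow> (\<exists>L. L-lipschitz_on UNIV g) \<longrightarrow>
     (\<lambda>n. \<integral>x. g x \<partial>meas (T n)) \<longlonglongrightarrow> (\<integral>x. g x \<partial>meas \<rho>))"

lemma lipschitz_borel_measurable:
  fixes g :: "'a::ordered_euclidean_space \<Rightarrow> real"
  shows "L-lipschitz_on UNIV g \<Longrightarrow> g \<in> borel_measurable borel"
  by (intro borel_measurable_continuous_onI lipschitz_on_continuous_on)

text \<open>The indicator of \<open>F\<close> is the pointwise limit of the functions
  \<open>max 0 (1 - real k * infdist x F)\<close>, which are bounded and Lipschitz with constant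
  \<open>k\<close>; dominated convergence transfers the equality.\<close>

lemma measure_closed_eqI:
  fixes A B :: "'a::ordered_euclidean_space law"
  assumes eq: "\<And>g :: 'a \<Rightarrow> real. bounded (range g) \<Longrightarrow> (\<exists>L. L-lipschitz_on UNIV g) \<Longrightarrow>
     (\<integral>x. g x \<partial>meas A) = (\<integral>x. g x \<partial>meas B)"
    and F: "closed F"
  shows "measure (meas A) F = measure (meas B) F"
\<comment> \<open>The distance \<open>infdist\<close> to the empty set is 0 by convention, so the
  approximation would converge to 1 there instead of 0.\<close>
proof (cases "F = {}")
  case False
  define g where "g k x = max 0 (1 - real k * infdist x F)" for k x
  have g_lim: "(\<lambda>k. g k x) \<longlonglongrightarrow> indicator F x" for x
  proof (cases "x \<in> F")
    case True
    then show ?thesis by (simp add: g_def)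
  next
    case x: False
    then have "0 < infdist x F"
      using F False infdist_pos_not_in_closed by blast
    then obtain n where n: "1 \<le> real n * infdist x F"
      by (meson reals_Archimedean3 less_imp_le)
    have "g k x = 0" if "n \<le> k" for k
    proof -
      have "real n * infdist x F \<le> real k * infdist x F"
        using that by (intro mult_right_mono) (auto simp: infdist_nonneg)
      then show ?thesis using n by (simp add: g_def)
    qed
    then have "\<forall>\<^sub>F k in sequentially. g k x = 0"
      by (auto simp: eventually_sequentially)
    then show ?thesis using x by (simp add: tendsto_eventually)
  qed
  have g_bound: "\<bar>g k x\<bar> \<le> 1" for k x
    by (auto simp: g_def infdist_nonneg)
  have g_lip: "(real k)-lipschitz_on UNIV (g k)" for k
  proof (rule lipschitz_onI)
    fix x y :: 'a
    have 1: "\<bar>infdist x F - infdist y F\<bar> \<le> dist x y"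
      using infdist_triangle_abs[of x F y] by simp
    have "dist (g k x) (g k y) \<le> \<bar>real k * infdist x F - real k * infdist y F\<bar>"
      by (auto simp: g_def dist_real_def max_def)
    also have "\<dots> = real k * \<bar>infdist x F - infdist y F\<bar>"
      by (simp add: abs_mult right_diff_distrib[symmetric])
    also have "\<dots> \<le> real k * dist x y"
      using 1 by (intro mult_left_mono) auto
    finally show "dist (g k x) (g k y) \<le> real k * dist x y" .
  qed simp
  have bdd: "bounded (range (g k))" for k
    using g_bound by (auto simp: bounded_iff)
  have lim: "(\<lambda>k. \<integral>x. g k x \<partial>meas C) \<longlonglongrightarrow> measure (meas C) F" for C :: "'a law"
  proof -
    interpret prob_space "meas C" by simp
    have "(\<lambda>k. \<integral>x. g k x \<partial>meas C) \<longlonglongrightarrow> (\<integral>x. indicator F x \<partial>meas C)"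
      using lipschitz_borel_measurable[OF g_lip] F g_lim g_bound
      by (intro integral_dominated_convergence[where w = "\<lambda>_. 1"])
        (auto intro!: borel_measurable_indicator)
    then show ?thesis using F by simp
  qed
  have "(\<lambda>k. \<integral>x. g k x \<partial>meas A) = (\<lambda>k. \<integral>x. g k x \<partial>meas B)"
    by (rule ext, rule eq[OF bdd], rule exI, rule g_lip)
  then show ?thesis using lim[of A] lim[of B] by (simp add: LIMSEQ_unique)
qed simp

text \<open>Closed sets form an intersection-stable generator of the Borel sets.\<close>

lemma law_eq_if_integral_eq:
  fixes A B :: "'a::ordered_euclidean_space law"
  assumes eq: "\<And>g :: 'a \<Rightarrow> real. bounded (range g) \<Longrightarrow> (\<exists>L. L-lipschitz_on UNIV g) \<Longrightarrow>
     (\<integral>x. g x \<partial>meas A) = (\<integral>x. g x \<partial>meas B)"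
  shows "A = B"
proof -
  interpret A: prob_space "meas A" by simp
  interpret B: prob_space "meas B" by simp
  have "meas A = meas B"
  proof (rule measure_eqI_generator_eq[where E = "Collect closed" and \<Omega> = UNIV and A = "\<lambda>_. UNIV"])
    show "sets (meas A) = sigma_sets UNIV (Collect closed)"
      "sets (meas B) = sigma_sets UNIV (Collect closed)"
      by (simp_all add: borel_eq_closed)
    show "emeasure (meas A) X = emeasure (meas B) X" if "X \<in> Collect closed" for X
      using measure_closed_eqI[OF eq] that by (simp add: A.emeasure_eq_measure B.emeasure_eq_measure)
  qed (auto simp: Int_stable_def A.emeasure_eq_measure)
  then show ?thesis by (simp add: meas_inject)
qed

lemma law_tendsto_unique:
  assumes "law_tendsto T \<rho>" "law_tendsto T \<rho>'"
  shows "\<rho> = \<rho>'"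
proof (rule law_eq_if_integral_eq)
  fix g :: "'a \<Rightarrow> real"
  assume "bounded (range g)" "\<exists>L. L-lipschitz_on UNIV g"
  then have "(\<lambda>n. \<integral>x. g x \<partial>meas (T n)) \<longlonglongrightarrow> (\<integral>x. g x \<partial>meas \<rho>)"
    "(\<lambda>n. \<integral>x. g x \<partial>meas (T n)) \<longlonglongrightarrow> (\<integral>x. g x \<partial>meas \<rho>')"
    using assms by (auto simp: law_tendsto_def)
  then show "(\<integral>x. g x \<partial>meas \<rho>) = (\<integral>x. g x \<partial>meas \<rho>')"
    by (rule LIMSEQ_unique)
qed

lemma law_tendsto_const: "law_tendsto (\<lambda>_. \<rho>) \<rho>"
  by (simp add: law_tendsto_def)

section \<open>Stability of weak limits\<close>

lemma (in prob_space) lipschitz_expectation_diff: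
  fixes g :: "'b::ordered_euclidean_space \<Rightarrow> real"
  assumes [measurable]: "Z \<in> borel_measurable M" "Y \<in> borel_measurable M"
    and K: "\<And>x. \<bar>g x\<bar> \<le> K" and L: "L-lipschitz_on UNIV g" and e: "0 \<le> e"
  shows "\<bar>(\<integral>\<omega>. g (Z \<omega>) \<partial>M) - (\<integral>\<omega>. g (Y \<omega>) \<partial>M)\<bar> \<le> L * e + 2 * K * prob {\<omega> \<in> space M. e < dist (Z \<omega>) (Y \<omega>)}"
proof -
  have [measurable]: "g \<in> borel_measurable borel"
    using L by (rule lipschitz_borel_measurable)
  define S where "S = {\<omega> \<in> space M. e < dist (Z \<omega>) (Y \<omega>)}"
  have [measurable]: "S \<in> sets M" by (simp add: S_def)
  have L0: "0 \<le> L" using L by (rule lipschitz_on_nonneg)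
  have K0: "0 \<le> K" using K[of 0] by linarith
  have int: "integrable M (\<lambda>\<omega>. g (Z \<omega>))" "integrable M (\<lambda>\<omega>. g (Y \<omega>))"
    using K by (auto intro!: integrable_const_bound[where B = K])
  have "\<bar>(\<integral>\<omega>. g (Z \<omega>) \<partial>M) - (\<integral>\<omega>. g (Y \<omega>) \<partial>M)\<bar> = \<bar>\<integral>\<omega>. g (Z \<omega>) - g (Y \<omega>) \<partial>M\<bar>"
    using int by simp
  also have "\<dots> \<le> (\<integral>\<omega>. \<bar>g (Z \<omega>) - g (Y \<omega>)\<bar> \<partial>M)"
    by (rule integral_abs_bound)
  also have "\<dots> \<le> (\<integral>\<omega>. L * e + 2 * K * indicator S \<omega> \<partial>M)"
  proof (rule integral_mono)
    fix \<omega> assume \<omega>: "\<omega> \<in> space M"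
    show "\<bar>g (Z \<omega>) - g (Y \<omega>)\<bar> \<le> L * e + 2 * K * indicator S \<omega>"
    proof (cases "\<omega> \<in> S")
      case True
      have "0 \<le> L * e" using L0 e by simp
      moreover have "\<bar>g (Z \<omega>) - g (Y \<omega>)\<bar> \<le> 2 * K"
        using K[of "Z \<omega>"] K[of "Y \<omega>"] by linarith
      ultimately show ?thesis using True by simp
    next
      case False
      have "\<bar>g (Z \<omega>) - g (Y \<omega>)\<bar> \<le> L * dist (Z \<omega>) (Y \<omega>)"
        using lipschitz_onD[OF L, of "Z \<omega>" "Y \<omega>"] by (simp add: dist_real_def)
      also have "\<dots> \<le> L * e"
        using False \<omega> L0 by (intro mult_left_mono) (auto simp: S_def)
      finally show ?thesis using False by simp
    qed
  next
    show "integrable M (\<lambda>\<omega>. L * e + 2 * K * indicator S \<omega>)"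
      using finite_measure by (intro integrable_const_bound[where B = "L * e + 2 * K"]) (auto simp: L0 K0 e indicator_def)
  qed (use int in auto)
  also have "\<dots> = L * e + 2 * K * prob S"
    using prob_space finite_measure by (subst Bochner_Integration.integral_add) (auto intro!: integrable_real_indicator simp: emeasure_eq_measure)
  finally show ?thesis by (simp add: S_def)
qed

text \<open>Here \<open>e\<close> is chosen before the limit is taken: \<open>L * e\<close> is made
  small first, then \<open>p e\<close> is sent to 0.\<close>

lemma tendsto_0_if_arbitrarily_close:
  fixes f :: "'i \<Rightarrow> real"
  assumes f: "\<And>e n. 0 < e \<Longrightarrow> \<bar>f n\<bar> \<le> L * e + C * p e n"
    and p: "\<And>e. 0 < e \<Longrightarrow> (p e \<longlongrightarrow> 0) F" and L: "0 \<le> L"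
  shows "(f \<longlongrightarrow> 0) F"
proof (rule tendstoI)
  fix e :: real assume e: "0 < e"
  \<comment> \<open>The summand 1 keeps the quotient meaningful when \<open>L = 0\<close>.\<close>
  define d where "d = e / (2 * (L + 1))"
  have d: "0 < d" using e L by (simp add: d_def)
  have Ld: "L * d \<le> e / 2"
    using e L by (simp add: d_def field_simps)
  have "((\<lambda>n. C * p d n) \<longlongrightarrow> 0) F"
    by (rule tendsto_mult_right_zero[OF p[OF d]])
  then have "\<forall>\<^sub>F n in F. C * p d n < e / 2"
    using e by (intro order_tendstoD) auto
  then show "\<forall>\<^sub>F n in F. dist (f n) 0 < e"
  proof eventually_elim
    case (elim n)
    then show ?case using f[OF d, of n] Ld by simp
  qed
qed

lemma (in prob_space) law_tendsto_if_in_prob: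
  fixes Z :: "nat \<Rightarrow> 'a \<Rightarrow> 'b::ordered_euclidean_space"
  assumes [measurable]: "\<And>n. Z n \<in> borel_measurable M" "Y \<in> borel_measurable M"
    and lim: "\<And>e. 0 < e \<Longrightarrow> (\<lambda>n. prob {\<omega> \<in> space M. e < dist (Z n \<omega>) (Y \<omega>)}) \<longlonglongrightarrow> 0"
  shows "law_tendsto (\<lambda>n. law M (Z n)) (law M Y)"
  unfolding law_tendsto_def
proof (intro allI impI)
  fix g :: "'b \<Rightarrow> real"
  assume "bounded (range g)" "\<exists>L. L-lipschitz_on UNIV g"
  then obtain K L where K: "\<And>x. \<bar>g x\<bar> \<le> K" and L: "L-lipschitz_on UNIV g"
    by (auto simp: bounded_iff)
  have [measurable]: "g \<in> borel_measurable borel"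
    using L by (rule lipschitz_borel_measurable)
  have eq: "(\<integral>x. g x \<partial>meas (law M V)) = (\<integral>\<omega>. g (V \<omega>) \<partial>M)" if "V \<in> borel_measurable M" for V
    using that by (simp add: meas_law integral_distr)
  have "(\<lambda>n. (\<integral>\<omega>. g (Z n \<omega>) \<partial>M) - (\<integral>\<omega>. g (Y \<omega>) \<partial>M)) \<longlonglongrightarrow> 0"
    by (rule tendsto_0_if_arbitrarily_close
        [OF lipschitz_expectation_diff[OF assms(1,2) K L] lim lipschitz_on_nonneg[OF L]]) simp_all
  then show "(\<lambda>n. \<integral>x. g x \<partial>meas (law M (Z n))) \<longlonglongrightarrow> (\<integral>x. g x \<partial>meas (law M Y))"
    by (simp add: eq LIM_zero_iff)
qed

text \<open>On the product space the first projection has law \<open>A\<close>, the sum of the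
  projections has law \<open>A + B\<close>, and their distance is the norm of the second projection.
  This reduces the claim to \<open>lipschitz_expectation_diff\<close>.\<close>

lemma law_integral_plus_diff:
  fixes g :: "'a::ordered_euclidean_space \<Rightarrow> real"
  assumes K: "\<And>x. \<bar>g x\<bar> \<le> K" and L: "L-lipschitz_on UNIV g" and e: "0 \<le> e"
  shows "\<bar>(\<integral>x. g x \<partial>meas (A + B)) - (\<integral>x. g x \<partial>meas A)\<bar> \<le> L * e + 2 * K * tail B e"
proof -
  interpret A: prob_space "meas A" by simp
  interpret B: prob_space "meas B" by simp
  interpret AB: pair_prob_space "meas A" "meas B" ..
  have [measurable]: "g \<in> borel_measurable borel"
    using L by (rule lipschitz_borel_measurable)
  have "(\<integral>x. g x \<partial>meas (A + B)) = (\<integral>z. g (fst z + snd z) \<partial>(meas A \<Otimes>\<^sub>M meas B))"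
    unfolding meas_plus convolution_def by (subst integral_distr) (auto simp: case_prod_beta)
  moreover have "distr (meas A \<Otimes>\<^sub>M meas B) (meas A) fst = meas A"
    by (rule B.distr_pair_fst)
  then have "(\<integral>x. g x \<partial>meas A) = (\<integral>z. g (fst z) \<partial>(meas A \<Otimes>\<^sub>M meas B))"
    using integral_distr[of fst "meas A \<Otimes>\<^sub>M meas B" "meas A" g] by simp
  moreover have "AB.prob {z \<in> space (meas A \<Otimes>\<^sub>M meas B). e < dist (fst z + snd z) (fst z)} = tail B e"
  proof -
    have "{z \<in> space (meas A \<Otimes>\<^sub>M meas B). e < dist (fst z + snd z) (fst z)} = UNIV \<times> {y. e < norm y}"
      by (auto simp: space_pair_measure dist_norm)
    then show ?thesis
      using B.emeasure_pair_measure_Times[of UNIV "meas A" "{y. e < norm y}"] A.emeasure_space_1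
      by (simp add: tail_def measure_def)
  qed
  ultimately show ?thesis
    using AB.lipschitz_expectation_diff[of "\<lambda>z. fst z + snd z" fst g K L e] K L e by simp
qed

text \<open>A Slutsky argument: the expectations of a Lipschitz test function under
  \<open>T n\<close> and \<open>S n\<close> differ by a null sequence, so either sequence inherits
  the limit of the other. It does the work of cancelling the remainder \<open>E n\<close>.\<close>

lemma law_tendsto_perturb_iff:
  assumes T: "\<And>n. T n = S n + E n" and E: "\<And>e. 0 < e \<Longrightarrow> (\<lambda>n. tail (E n) e) \<longlonglongrightarrow> 0"
  shows "law_tendsto T \<rho> \<longleftrightarrow> law_tendsto S \<rho>"
proof -
  have "(\<lambda>n. \<integral>x. g x \<partial>meas (T n)) \<longlonglongrightarrow> l \<longleftrightarrow> (\<lambda>n. \<integral>x. g x \<partial>meas (S n)) \<longlonglongrightarrow> l"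
    if g: "bounded (range g)" "\<exists>L. L-lipschitz_on UNIV g" for g :: "'a \<Rightarrow> real" and l
  proof -
    obtain K L where K: "\<And>x. \<bar>g x\<bar> \<le> K" and L: "L-lipschitz_on UNIV g"
      using g by (auto simp: bounded_iff)
    have diff: "(\<lambda>n. (\<integral>x. g x \<partial>meas (T n)) - (\<integral>x. g x \<partial>meas (S n))) \<longlonglongrightarrow> 0"
      unfolding T
      by (rule tendsto_0_if_arbitrarily_close
          [OF law_integral_plus_diff[OF K L] E lipschitz_on_nonneg[OF L]]) simp_all
    show ?thesis
      using tendsto_diff[OF _ diff, of "\<lambda>n. \<integral>x. g x \<partial>meas (T n)" l]
        tendsto_add[OF _ diff, of "\<lambda>n. \<integral>x. g x \<partial>meas (S n)" l] by auto
  qed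
  then show ?thesis unfolding law_tendsto_def by (intro iff_allI imp_cong refl)
qed

lemma law_tendsto_lscale:
  assumes "law_tendsto T \<rho>"
  shows "law_tendsto (\<lambda>n. lscale c (T n)) (lscale c \<rho>)"
  unfolding law_tendsto_def
proof (intro allI impI)
  fix g :: "'a \<Rightarrow> real"
  assume g: "bounded (range g)" "\<exists>L. L-lipschitz_on UNIV g"
  then obtain L where L: "L-lipschitz_on UNIV g" by blast
  then have [measurable]: "g \<in> borel_measurable borel"
    by (rule lipschitz_borel_measurable)
  have "\<bar>c\<bar>-lipschitz_on UNIV (\<lambda>x :: 'a. c *\<^sub>R x)"
    by (intro lipschitz_onI) (simp_all add: dist_norm scaleR_diff_right[symmetric])
  then have "(L * \<bar>c\<bar>)-lipschitz_on UNIV (g \<circ> (\<lambda>x. c *\<^sub>R x))"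
    by (rule lipschitz_on_compose) (rule lipschitz_on_subset[OF L], simp)
  moreover have "bounded (range (g \<circ> (\<lambda>x. c *\<^sub>R x)))"
    using g(1) by (rule bounded_subset) auto
  ultimately have "(\<lambda>n. \<integral>x. (g \<circ> (\<lambda>x. c *\<^sub>R x)) x \<partial>meas (T n)) \<longlonglongrightarrow> (\<integral>x. (g \<circ> (\<lambda>x. c *\<^sub>R x)) x \<partial>meas \<rho>)"
    using assms unfolding law_tendsto_def by blast
  moreover have "(\<integral>x. g x \<partial>meas (lscale c A)) = (\<integral>x. g (c *\<^sub>R x) \<partial>meas A)" for A
    unfolding lscale_def prob_space.meas_law[OF prob_space_meas, of "\<lambda>x. c *\<^sub>R x" A, simplified]
    by (subst integral_distr) auto
  ultimately show "(\<lambda>n. \<integral>x. g x \<partial>meas (lscale c (T n))) \<longlonglongrightarrow> (\<integral>x. g x \<partial>meas (lscale c \<rho>))"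
    by simp
qed

text \<open>Averaging a test function over \<open>A\<close> gives \<open>h\<close>, which has the
  same bound and the same Lipschitz constant; by Fubini, integrating \<open>g\<close> against
  \<open>A + B\<close> is integrating \<open>h\<close> against \<open>B\<close>.\<close>

lemma law_tendsto_plus_const:
  assumes "law_tendsto T \<rho>"
  shows "law_tendsto (\<lambda>n. A + T n) (A + \<rho>)"
  unfolding law_tendsto_def
proof (intro allI impI)
  fix g :: "'a \<Rightarrow> real"
  assume g: "bounded (range g)" "\<exists>L. L-lipschitz_on UNIV g"
  then obtain K L where K: "\<And>x. \<bar>g x\<bar> \<le> K" and L: "L-lipschitz_on UNIV g"
    by (auto simp: bounded_iff)
  have [measurable]: "g \<in> borel_measurable borel"
    using L by (rule lipschitz_borel_measurable)
  interpret A: prob_space "meas A" by simp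
  define h where "h y = (\<integral>x. g (x + y) \<partial>meas A)" for y
  have int: "integrable (meas A) (\<lambda>x. g (x + y))" for y
    using K by (intro A.integrable_const_bound[where B = K]) auto
  have "L-lipschitz_on UNIV h"
  proof (rule lipschitz_onI)
    fix y z :: 'a
    have "dist (h y) (h z) = \<bar>\<integral>x. g (x + y) - g (x + z) \<partial>meas A\<bar>"
      using int by (simp add: h_def dist_real_def)
    also have "\<dots> \<le> (\<integral>x. \<bar>g (x + y) - g (x + z)\<bar> \<partial>meas A)"
      by (rule integral_abs_bound)
    also have "\<dots> \<le> (\<integral>x. L * dist y z \<partial>meas A)"
      using int lipschitz_onD[OF L, of "x + y" "x + z" for x]
      by (intro integral_mono) (auto simp: dist_real_def)
    finally show "dist (h y) (h z) \<le> L * dist y z"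
      using A.prob_space by simp
  qed (rule lipschitz_on_nonneg[OF L])
  moreover have "\<bar>h y\<bar> \<le> K" for y
  proof -
    have "\<bar>h y\<bar> \<le> (\<integral>x. \<bar>g (x + y)\<bar> \<partial>meas A)"
      unfolding h_def by (rule integral_abs_bound)
    also have "\<dots> \<le> (\<integral>x. K \<partial>meas A)"
      using int K by (intro integral_mono) auto
    finally show ?thesis using A.prob_space by simp
  qed
  then have "bounded (range h)"
    by (auto simp: bounded_iff)
  ultimately have "(\<lambda>n. \<integral>x. h x \<partial>meas (T n)) \<longlonglongrightarrow> (\<integral>x. h x \<partial>meas \<rho>)"
    using assms unfolding law_tendsto_def by blast
  moreover have "(\<integral>x. g x \<partial>meas (A + B)) = (\<integral>x. h x \<partial>meas B)" for B
  proof -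
    interpret B: prob_space "meas B" by simp
    interpret BA: pair_prob_space "meas B" "meas A" ..
    have "integrable (meas B \<Otimes>\<^sub>M meas A) (\<lambda>(y, x). g (x + y))"
      using K by (intro BA.integrable_const_bound[where B = K]) auto
    then have "(\<integral>y. h y \<partial>meas B) = (\<integral>z. (case z of (y, x) \<Rightarrow> g (x + y)) \<partial>(meas B \<Otimes>\<^sub>M meas A))"
      unfolding h_def using BA.integral_fst'[of "\<lambda>(y, x). g (x + y)"] by simp
    also have "\<dots> = (\<integral>x. g x \<partial>meas (B + A))"
      unfolding meas_plus convolution_def
      by (subst integral_distr) (auto simp: case_prod_beta intro!: Bochner_Integration.integral_cong arg_cong[where f = g] add.commute)
    finally show ?thesis by (simp add: add.commute)
  qed
  ultimately show "(\<lambda>n. \<integral>x. g x \<partial>meas (A + T n)) \<longlonglongrightarrow> (\<integral>x. g x \<partial>meas (A + \<rho>))"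
    by simp
qed

section \<open>Logarithmic moments\<close>

definition logp :: "real \<Rightarrow> real" where
  "logp r = max (ln r) 0"

lemma logp_nonneg [simp]: "0 \<le> logp r"
  by (simp add: logp_def)

lemma logp_mono: "0 \<le> r \<Longrightarrow> r \<le> s \<Longrightarrow> logp r \<le> logp s"
  by (cases "r = 0") (auto simp: logp_def le_max_iff_disj)

lemma borel_measurable_logp [measurable]: "logp \<in> borel_measurable borel"
  unfolding logp_def by measurable

lemma power_add_le: 
  fixes x y :: real
  assumes "0 \<le> x" "0 \<le> y"
  shows "(x + y) ^ k \<le> 2 ^ k * (x ^ k + y ^ k)"
proof -
  have "(x + y) ^ k \<le> (2 * max x y) ^ k"
    using assms by (intro power_mono) auto
  also have "\<dots> = 2 ^ k * (max x y) ^ k"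
    by (rule power_mult_distrib)
  also have "(max x y) ^ k \<le> x ^ k + y ^ k"
    using assms by (auto simp: max_def)
  finally show ?thesis by simp
qed

definition log_moment :: "nat \<Rightarrow> 'a::ordered_euclidean_space law \<Rightarrow> bool" where
  "log_moment k A \<longleftrightarrow> (\<integral>\<^sup>+x. ennreal (logp (norm x) ^ k) \<partial>meas A) < \<infinity>"

lemma log_moment_bound:
  assumes "log_moment k A" "\<And>x. 0 \<le> f x" "\<And>x. f x \<le> C * logp (norm x) ^ k + D"
    and [measurable]: "f \<in> borel_measurable borel" 
  shows "integrable (meas A) f"
proof -
  interpret prob_space "meas A" by simp
  have "integrable (meas A) (\<lambda>x. logp (norm x) ^ k)"
    using assms(1) by (intro integrableI_nonneg) (auto simp: log_moment_def)
  then have "integrable (meas A) (\<lambda>x. C * logp (norm x) ^ k + D)"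
    by (intro Bochner_Integration.integrable_add integrable_mult_right) auto
  then show ?thesis
    by (rule Bochner_Integration.integrable_bound) (use assms(2,3) in \<open>auto intro!: AE_I2 intro: order_trans[OF _ abs_ge_self]\<close>)
qed

lemma log_moment_iff_integrable:
  "log_moment k A \<longleftrightarrow> integrable (meas A) (\<lambda>x. logp (norm x) ^ k)"
  unfolding log_moment_def
  by (auto intro!: integrableI_nonneg dest!: nn_integral_eq_integral)

lemma log_moment_Suc_imp: "log_moment (Suc k) A \<Longrightarrow> log_moment k A"
  unfolding log_moment_iff_integrable[of k]
proof (rule log_moment_bound[where C = 1 and D = 1])
  fix x :: 'a
  show "logp (norm x) ^ k \<le> 1 * logp (norm x) ^ Suc k + 1"
  proof (cases "logp (norm x) \<le> 1")
    case True
    then have "logp (norm x) ^ k \<le> 1" by (simp add: power_le_one)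
    then show ?thesis by (simp add: add_increasing)
  next
    case False
    then have "logp (norm x) ^ k \<le> logp (norm x) ^ Suc k" by (intro power_increasing) auto
    then show ?thesis by simp
  qed
qed auto

text \<open>By Fubini the shifted moment of \<open>A\<close> is finite for almost every shift
  \<open>y\<close> drawn from \<open>B\<close>. One such \<open>y\<close> is fixed, and undoing a
  fixed shift costs only an additive constant in the logarithm.\<close>

lemma log_moment_plusD:
  fixes A B :: "'a::ordered_euclidean_space law"
  assumes "log_moment k (A + B)"
  shows "log_moment k A"
proof -
  interpret B: prob_space "meas B" by simp
  have "(\<integral>\<^sup>+y. \<integral>\<^sup>+x. ennreal (logp (norm (y + x)) ^ k) \<partial>meas A \<partial>meas B) < \<infinity>"
    using assms unfolding log_moment_def add.commute[of A B]
    by (subst (asm) nn_integral_plus_law) auto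
  then have "AE y in meas B. (\<integral>\<^sup>+x. ennreal (logp (norm (y + x)) ^ k) \<partial>meas A) \<noteq> \<infinity>"
    by (intro nn_integral_PInf_AE) auto
  then obtain y where y: "(\<integral>\<^sup>+x. ennreal (logp (norm (y + x)) ^ k) \<partial>meas A) \<noteq> \<infinity>"
    using eventually_happens'[OF B.ae_filter_bot] by blast
  have bound: "logp (norm x) ^ k \<le> 2 ^ k * logp (norm (y + x)) ^ k + 2 ^ k * (ln 2 + logp (norm y)) ^ k" for x
  proof -
    have "norm x \<le> norm (y + x) + norm y"
      using norm_triangle_ineq4[of "y + x" y] by simp
    then have le: "norm x \<le> 2 * max (norm (y + x)) (norm y)" by linarith
    have "logp (norm x) \<le> logp (norm (y + x)) + (ln 2 + logp (norm y))"
    proof (cases "norm x \<le> 1")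
      case True
      then have "logp (norm x) = 0"
        by (cases "norm x = 0") (auto simp: logp_def)
      then show ?thesis by (simp add: add_nonneg_nonneg)
    next
      case False
      define w where "w = max (norm (y + x)) (norm y)"
      have "0 < w" using le False by (simp add: w_def)
      have "logp (norm x) = ln (norm x)" using False by (simp add: logp_def)
      also have "\<dots> \<le> ln (2 * w)" using le False unfolding w_def by (subst ln_le_cancel_iff) auto
      also have "\<dots> = ln 2 + ln w" using \<open>0 < w\<close> by (simp add: ln_mult)
      also have "ln w \<le> logp (norm (y + x)) + logp (norm y)"
        by (auto simp: w_def max_def logp_def)
      finally show ?thesis by simp
    qed
    then have "logp (norm x) ^ k \<le> (logp (norm (y + x)) + (ln 2 + logp (norm y))) ^ k"
      by (rule power_mono) simp
    also have "\<dots> \<le> 2 ^ k * (logp (norm (y + x)) ^ k + (ln 2 + logp (norm y)) ^ k)"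
      by (rule power_add_le) auto
    finally show ?thesis by (simp add: distrib_left)
  qed
  interpret A: prob_space "meas A" by simp
  have "integrable (meas A) (\<lambda>x. logp (norm (y + x)) ^ k)"
    using y by (intro integrableI_nonneg) (auto simp: less_top)
  then have "integrable (meas A) (\<lambda>x. 2 ^ k * logp (norm (y + x)) ^ k + 2 ^ k * (ln 2 + logp (norm y)) ^ k)"
    by (intro Bochner_Integration.integrable_add integrable_mult_right) auto
  then show ?thesis
    unfolding log_moment_iff_integrable
    by (rule Bochner_Integration.integrable_bound) (use bound in \<open>auto intro!: AE_I2 intro: order_trans[OF _ abs_ge_self]\<close>)
qed

lemma log_moment_nmulD: "log_moment k (nmul n A) \<Longrightarrow> 0 < n \<Longrightarrow> log_moment k A"
  by (cases n) (auto dest: log_moment_plusD)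

section \<open>Logarithmic moments and tails along geometric sequences\<close>

lemma less_logp_if_power_less:
  assumes c: "1 < c" and "c ^ n < r"
  shows "real n < logp r / ln c"
proof -
  have "1 \<le> c ^ n" using c by simp
  then have "ln (c ^ n) < ln r" using assms(2) by (subst ln_less_cancel_iff) linarith+
  then have "real n * ln c < logp r" using c by (simp add: ln_realpow logp_def)
  then show ?thesis using c by (simp add: less_divide_eq)
qed

lemma logp_scaled_power_bound:
  assumes "1 < c"
  shows "(logp r / ln c + 1) ^ k \<le> (2 / ln c) ^ k * logp r ^ k + 2 ^ k"
proof -
  have "(logp r / ln c + 1) ^ k \<le> 2 ^ k * ((logp r / ln c) ^ k + 1 ^ k)"
    using assms by (intro power_add_le) auto
  then show ?thesis by (simp add: distrib_left power_divide)
qed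

text \<open>On the event \<open>c ^ n < norm x\<close> the index \<open>n\<close> is below the
  logarithm of \<open>norm x\<close> to base \<open>c\<close>, so the weight
  \<open>real (Suc n) ^ k\<close> is dominated by an integrable function that does not depend on
  \<open>n\<close>.\<close>

lemma log_moment_tail_tendsto:
  assumes A: "log_moment k A" and c: "1 < c"
  shows "(\<lambda>n. real (Suc n) ^ k * tail A (c ^ n)) \<longlonglongrightarrow> 0"
proof -
  interpret prob_space "meas A" by simp
  have "(\<lambda>n. \<integral>x. real (Suc n) ^ k * indicator {x. c ^ n < norm x} x \<partial>meas A) \<longlonglongrightarrow> (\<integral>x. 0 \<partial>meas A)"
  proof (rule integral_dominated_convergence[where w = "\<lambda>x. (logp (norm x) / ln c + 1) ^ k"])
    show "integrable (meas A) (\<lambda>x. (logp (norm x) / ln c + 1) ^ k)"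
      using c by (intro log_moment_bound[OF A]) (auto intro!: logp_scaled_power_bound)
    show "AE x in meas A. (\<lambda>n. real (Suc n) ^ k * indicator {x. c ^ n < norm x} x) \<longlonglongrightarrow> 0"
    proof (rule AE_I2)
      fix x :: 'a
      obtain n where n: "norm x < c ^ n" using c real_arch_pow by blast
      have "real (Suc i) ^ k * indicator {x. c ^ i < norm x} x = 0" if "n \<le> i" for i
      proof -
        have "c ^ n \<le> c ^ i" using c that by (simp add: power_increasing)
        then show ?thesis using n by simp
      qed
      then show "(\<lambda>n. real (Suc n) ^ k * indicator {x. c ^ n < norm x} x) \<longlonglongrightarrow> 0"
        by (intro tendsto_eventually) (auto simp: eventually_sequentially)
    qed
    show "AE x in meas A. norm (real (Suc i) ^ k * indicator {x. c ^ i < norm x} x) \<le> (logp (norm x) / ln c + 1) ^ k" for i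
    proof (rule AE_I2)
      fix x :: 'a
      show "norm (real (Suc i) ^ k * indicator {x. c ^ i < norm x} x) \<le> (logp (norm x) / ln c + 1) ^ k"
      proof (cases "c ^ i < norm x")
        case True
        then have "real (Suc i) ^ k \<le> (logp (norm x) / ln c + 1) ^ k"
          using less_logp_if_power_less[OF c True] by (intro power_mono) auto
        then show ?thesis using True by simp
      qed (use c in simp)
    qed
  qed auto
  then show ?thesis by (simp add: tail_def)
qed

text \<open>The sum is taken inside the integral. For fixed \<open>x\<close> the contributing
  indices lie below the logarithm of \<open>norm x\<close> to base \<open>c\<close>, and each weight
  is at most the \<open>m\<close>-th power of that logarithm plus 1. Counting the indices
  contributes one more logarithm, hence the order \<open>Suc m\<close>.\<close>

lemma log_moment_tail_summable:
  assumes A: "log_moment (Suc m) A" and c: "1 < c" and N: "\<And>j. N j \<le> Suc j ^ m"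
  shows "summable (\<lambda>j. real (N j) * tail A (c ^ j))"
proof (rule summableI_nonneg_bounded)
  interpret prob_space "meas A" by simp
  let ?w = "\<lambda>x :: 'a. (logp (norm x) / ln c + 1) ^ Suc m"
  have w: "integrable (meas A) ?w"
    by (rule log_moment_bound[OF A _ logp_scaled_power_bound[OF c]]) (use c in auto)
  fix n
  have "(\<Sum>j<n. real (N j) * tail A (c ^ j)) = (\<integral>x. (\<Sum>j<n. real (N j) * indicator {x. c ^ j < norm x} x) \<partial>meas A)"
    by (subst Bochner_Integration.integral_sum) (auto simp: tail_def emeasure_eq_measure intro!: integrable_mult_right)
  also have "\<dots> \<le> (\<integral>x. ?w x \<partial>meas A)"
  proof (rule integral_mono[OF _ w])
    show "integrable (meas A) (\<lambda>x. \<Sum>j<n. real (N j) * indicator {x. c ^ j < norm x} x)"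
      by (intro Bochner_Integration.integrable_sum integrable_mult_right) (auto simp: emeasure_eq_measure)
    fix x :: 'a
    define l where "l = logp (norm x) / ln c"
    have l: "0 \<le> l" using c by (simp add: l_def)
    have "(\<Sum>j<n. real (N j) * indicator {x. c ^ j < norm x} x) \<le> (\<Sum>j<n. if real j < l then (l + 1) ^ m else 0)"
    proof (rule sum_mono)
      fix j
      show "real (N j) * indicator {x. c ^ j < norm x} x \<le> (if real j < l then (l + 1) ^ m else 0)"
      proof (cases "c ^ j < norm x")
        case True
        then have j: "real j < l" unfolding l_def by (rule less_logp_if_power_less[OF c])
        have "real (N j) \<le> real (Suc j ^ m)" using N[of j] by (rule of_nat_mono)
        also have "\<dots> = real (Suc j) ^ m" by simp
        also have "\<dots> \<le> (l + 1) ^ m" using j by (intro power_mono) auto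
        finally show ?thesis using True j by simp
      qed (use l in auto)
    qed
    also have "\<dots> = (\<Sum>j\<in>{j\<in>{..<n}. real j < l}. (l + 1) ^ m)"
      by (rule sum.inter_filter[symmetric]) simp
    also have "\<dots> = real (card {j\<in>{..<n}. real j < l}) * (l + 1) ^ m" by simp
    also have "\<dots> \<le> (l + 1) * (l + 1) ^ m"
    proof (rule mult_right_mono)
      have "{j\<in>{..<n}. real j < l} \<subseteq> {..<nat \<lceil>l\<rceil>}" by (auto simp: zless_nat_eq_int_zless less_ceiling_iff)
      then have "card {j\<in>{..<n}. real j < l} \<le> card {..<nat \<lceil>l\<rceil>}" by (rule card_mono[rotated]) simp
      then have "card {j\<in>{..<n}. real j < l} \<le> nat \<lceil>l\<rceil>" by simp
      then have "real (card {j\<in>{..<n}. real j < l}) \<le> real (nat \<lceil>l\<rceil>)" by (rule of_nat_mono)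
      also have "\<dots> \<le> l + 1" using l by linarith
      finally show "real (card {j\<in>{..<n}. real j < l}) \<le> l + 1" .
    qed (use l in auto)
    finally show "(\<Sum>j<n. real (N j) * indicator {x. c ^ j < norm x} x) \<le> ?w x"
      by (simp add: l_def)
  qed
  finally show "(\<Sum>j<n. real (N j) * tail A (c ^ j)) \<le> (\<integral>x. ?w x \<partial>meas A)" .
qed simp

section \<open>Moments of a self-similar law\<close>

text \<open>Two disjoint events force \<open>u + v\<close> to be large: \<open>u\<close> is large and \<open>v\<close> is not, or conversely.\<close>

lemma lscale_fixpoint_nn_integral_ge:
  fixes \<mu> \<rho> :: "'a::ordered_euclidean_space law"
  assumes \<rho>: "\<rho> = \<mu> + lscale (1 / b) \<rho>" and b: "1 < b" and x: "0 < x" and s: "0 < s"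
    and tail: "tail \<rho> (b * x) \<le> 1 / 4"
    and \<phi>: "\<And>r s. 0 \<le> r \<Longrightarrow> r \<le> s \<Longrightarrow> \<phi> r \<le> (\<phi> s :: ennreal)"
    and [measurable]: "\<phi> \<in> borel_measurable borel"
  shows "ennreal (3 / 4) * (\<integral>\<^sup>+u. \<phi> (norm u / (2 * s)) * indicator {u. 2 * x < norm u} u \<partial>meas \<mu>)
      + ennreal (1 - tail \<mu> (2 * x)) * (\<integral>\<^sup>+y. \<phi> (norm y / (3 * b * s)) * indicator {y. 3 * b * x < norm y} y \<partial>meas \<rho>)
      \<le> (\<integral>\<^sup>+y. \<phi> (norm y / s) * indicator {y. x < norm y} y \<partial>meas \<rho>)"
    (is "ennreal (3 / 4) * ?I1 + _ * ?I2 \<le> ?I0")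
proof -
  define \<nu> where "\<nu> = lscale (1 / b) \<rho>"
  interpret \<mu>: prob_space "meas \<mu>" by simp
  interpret \<nu>: prob_space "meas \<nu>" by simp
  define f where "f u = \<phi> (norm u / (2 * s)) * indicator {u. 2 * x < norm u} u" for u :: 'a
  define g where "g v = \<phi> (norm v / (3 * s)) * indicator {v. 3 * x < norm v} v" for v :: 'a
  have [measurable]: "f \<in> borel_measurable borel" "g \<in> borel_measurable borel"
    unfolding f_def[abs_def] g_def[abs_def] by measurable
  \<comment> \<open>The complement of this ball has \<open>\<nu>\<close>-mass
    \<open>tail \<rho> (b * x)\<close>, which is at most 1/4.\<close>
  have \<nu>x: "emeasure (meas \<nu>) {v. norm v \<le> x} \<ge> ennreal (3 / 4)"
  proof -
    have "\<nu>.prob {v. norm v \<le> x} = 1 - \<nu>.prob {v. x < norm v}"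
      using \<nu>.prob_compl[of "{v. x < norm v}"] by (simp add: Compl_eq_Diff_UNIV[symmetric] Collect_neg_eq[symmetric] not_less)
    also have "\<nu>.prob {v. x < norm v} = tail \<rho> (b * x)"
      using tail_lscale[of "1 / b" \<rho> x] b by (simp add: \<nu>_def tail_def mult.commute)
    finally have "3 / 4 \<le> \<nu>.prob {v. norm v \<le> x}" using tail by simp
    then show ?thesis by (simp add: \<nu>.emeasure_eq_measure)
  qed
  have \<mu>x: "emeasure (meas \<mu>) {u. norm u \<le> 2 * x} = ennreal (1 - tail \<mu> (2 * x))"
    using \<mu>.prob_compl[of "{v. 2 * x < norm v}"]
    by (simp add: Compl_eq_Diff_UNIV[symmetric] Collect_neg_eq[symmetric] not_less \<mu>.emeasure_eq_measure tail_def)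
  \<comment> \<open>Under \<open>\<nu>\<close> the variable is \<open>y / b\<close> with
    \<open>y\<close> drawn from \<open>\<rho>\<close>; this is where the threshold
    \<open>3 * b * x\<close> comes from.\<close>
  have g_int: "(\<integral>\<^sup>+v. g v \<partial>meas \<nu>) = ?I2"
    unfolding \<nu>_def using b
    by (subst nn_integral_lscale) (auto simp: g_def field_simps intro!: nn_integral_cong split: split_indicator)
  have "ennreal (3 / 4) * ?I1 + ennreal (1 - tail \<mu> (2 * x)) * ?I2
      \<le> emeasure (meas \<nu>) {v. norm v \<le> x} * (\<integral>\<^sup>+u. f u \<partial>meas \<mu>)
        + emeasure (meas \<mu>) {u. norm u \<le> 2 * x} * (\<integral>\<^sup>+v. g v \<partial>meas \<nu>)"
    unfolding g_int \<mu>x f_def by (intro add_mono mult_right_mono \<nu>x) auto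
  also have "\<dots> = (\<integral>\<^sup>+u. \<integral>\<^sup>+v. f u * indicator {v. norm v \<le> x} v + indicator {u. norm u \<le> 2 * x} u * g v \<partial>meas \<nu> \<partial>meas \<mu>)"
    by (simp add: nn_integral_add nn_integral_cmult nn_integral_multc mult.commute)
  also have "\<dots> \<le> (\<integral>\<^sup>+u. \<integral>\<^sup>+v. \<phi> (norm (u + v) / s) * indicator {y. x < norm y} (u + v) \<partial>meas \<nu> \<partial>meas \<mu>)"
  proof (intro nn_integral_mono)
    fix u v :: 'a
    have 1: "norm u - norm v \<le> norm (u + v)" "norm v - norm u \<le> norm (u + v)"
      using norm_diff_ineq[of u v] norm_diff_ineq[of v u] by (simp_all add: add.commute)
    \<comment> \<open>In case \<open>u\<close> the smaller vector is below half of the larger one,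
      in case \<open>v\<close> it is below two thirds. The sum thus keeps at least a half,
      respectively a third, of the larger norm, and it exceeds \<open>x\<close> in both cases. These
      are the factors 2 and 3 in the statement.\<close>
    consider (u) "2 * x < norm u" "norm v \<le> x" | (v) "norm u \<le> 2 * x" "3 * x < norm v"
      | (other) "\<not> (2 * x < norm u \<and> norm v \<le> x)" "\<not> (norm u \<le> 2 * x \<and> 3 * x < norm v)" by blast
    then show "f u * indicator {v. norm v \<le> x} v + indicator {u. norm u \<le> 2 * x} u * g v
        \<le> \<phi> (norm (u + v) / s) * indicator {y. x < norm y} (u + v)"
    proof cases
      case u
      then have "x < norm (u + v)" "norm u / 2 \<le> norm (u + v)" using 1 by linarith+
      moreover have "norm u / (2 * s) \<le> norm (u + v) / s"
        using divide_right_mono[OF calculation(2), of s] s by simp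
      ultimately show ?thesis using u \<phi>[of "norm u / (2 * s)" "norm (u + v) / s"] s
        by (simp add: f_def g_def)
    next
      case v
      then have "x < norm (u + v)" "norm v / 3 \<le> norm (u + v)" using 1 by linarith+
      moreover have "norm v / (3 * s) \<le> norm (u + v) / s"
        using divide_right_mono[OF calculation(2), of s] s by simp
      ultimately show ?thesis using v \<phi>[of "norm v / (3 * s)" "norm (u + v) / s"] s
        by (simp add: f_def g_def)
    next
      case other
      then show ?thesis by (auto simp: f_def g_def indicator_def)
    qed
  qed
  also have "\<dots> = (\<integral>\<^sup>+y. \<phi> (norm y / s) * indicator {y. x < norm y} y \<partial>meas (\<mu> + \<nu>))"
    by (simp add: nn_integral_plus_law)
  also have "\<mu> + \<nu> = \<rho>" unfolding \<nu>_def by (rule \<rho>[symmetric])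
  finally show ?thesis .
qed

text \<open>The one-step bound is iterated over the thresholds \<open>(3 * b) ^ j * x\<close>. Each
  step yields one integral against \<open>\<mu>\<close> and discounts the remaining ones by
  \<open>1 - H j\<close>. The accumulated discount stays bounded below by the same inequality for
  the constant test function 1, and not by an a priori summability of the tails of
  \<open>\<mu>\<close>.\<close>

lemma lscale_fixpoint_sum_le:
  fixes \<mu> \<rho> :: "'a::ordered_euclidean_space law"
  assumes \<rho>: "\<rho> = \<mu> + lscale (1 / b) \<rho>" and b: "1 < b" and x: "0 < x"
    and tail: "tail \<rho> x \<le> 1 / 4"
    and \<phi>: "\<And>r s. 0 \<le> r \<Longrightarrow> r \<le> s \<Longrightarrow> \<phi> r \<le> (\<phi> s :: ennreal)"
    and [measurable]: "\<phi> \<in> borel_measurable borel"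
  shows "ennreal (3 / 8) * (\<Sum>j<n. \<integral>\<^sup>+u. \<phi> (norm u / (2 * (3 * b) ^ j)) * indicator {u. 2 * ((3 * b) ^ j * x) < norm u} u \<partial>meas \<mu>)
      \<le> (\<integral>\<^sup>+y. \<phi> (norm y) \<partial>meas \<rho>)"
proof -
  define D where "D = 3 * b"
  have D: "1 < D" using b by (simp add: D_def)
  define F where "F \<phi> j = (\<integral>\<^sup>+y. \<phi> (norm y / D ^ j) * indicator {y. D ^ j * x < norm y} y \<partial>meas \<rho>)"
    for \<phi> :: "real \<Rightarrow> ennreal" and j
  define h where "h \<phi> j = (\<integral>\<^sup>+u. \<phi> (norm u / (2 * D ^ j)) * indicator {u. 2 * (D ^ j * x) < norm u} u \<partial>meas \<mu>)"
    for \<phi> :: "real \<Rightarrow> ennreal" and j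
  define H where "H j = tail \<mu> (2 * (D ^ j * x))" for j
  define p where "p n = (\<Prod>i<n. 1 - H i)" for n
  have H: "0 \<le> H j" "H j \<le> 1" for j by (simp_all add: H_def)
  have Dx: "0 < D ^ j * x" "0 < D ^ j" for j using D x by auto
  have tail_j: "tail \<rho> (D ^ j * x) \<le> 1 / 4" for j
  proof -
    have "1 * x \<le> D ^ j * x" using D x by (intro mult_right_mono) auto
    then show ?thesis using tail_antimono[of x "D ^ j * x" \<rho>] tail by simp
  qed
  have tail_bj: "tail \<rho> (b * (D ^ j * x)) \<le> 1 / 4" for j
  proof -
    have "1 * (D ^ j * x) \<le> b * (D ^ j * x)" using b Dx[of j] by (intro mult_right_mono) auto
    then show ?thesis using tail_antimono[of "D ^ j * x" "b * (D ^ j * x)" \<rho>] tail_j[of j] by simp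
  qed
  have step: "ennreal (3 / 4) * h \<psi> j + ennreal (1 - H j) * F \<psi> (Suc j) \<le> F \<psi> j"
    if "\<And>r s. 0 \<le> r \<Longrightarrow> r \<le> s \<Longrightarrow> \<psi> r \<le> \<psi> s" "\<psi> \<in> borel_measurable borel" for \<psi> j
    using lscale_fixpoint_nn_integral_ge[OF \<rho> b Dx tail_bj that, of j]
    by (simp add: h_def F_def H_def D_def mult.assoc)
  \<comment> \<open>For \<open>\<psi> = 1\<close> the step bounds the distances of the tails of \<open>\<rho>\<close> from \<open>3/4\<close>, which lie between \<open>1/2\<close> and \<open>1\<close>.\<close>
  have p_ge: "1 / 2 \<le> p n" for n
  proof -
    have F1: "F (\<lambda>_. 1) j = ennreal (tail \<rho> (D ^ j * x))" for j
      by (simp add: F_def emeasure_tail)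
    have h1: "h (\<lambda>_. 1) j = ennreal (H j)" for j
      by (simp add: h_def H_def emeasure_tail)
    have 0: "3 / 4 * H j + (1 - H j) * tail \<rho> (D ^ Suc j * x) \<le> tail \<rho> (D ^ j * x)" for j
    proof -
      have "ennreal (3 / 4 * H j + (1 - H j) * tail \<rho> (D ^ Suc j * x)) \<le> ennreal (tail \<rho> (D ^ j * x))"
        using step[of "\<lambda>_. 1" j] H[of j] unfolding F1 h1
        by (subst ennreal_plus) (simp_all only: ennreal_mult tail_nonneg, auto)
      then show ?thesis by (simp add: ennreal_le_iff)
    qed
    have 1: "3 / 4 - tail \<rho> (D ^ j * x) \<le> (1 - H j) * (3 / 4 - tail \<rho> (D ^ Suc j * x))" for j
      using 0[of j] by (simp add: algebra_simps diff_divide_distrib)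
    have p0: "0 \<le> p n" for n using H by (auto simp: p_def intro!: prod_nonneg)
    have "3 / 4 - tail \<rho> x \<le> p n * (3 / 4 - tail \<rho> (D ^ n * x))" for n
    proof (induction n)
      case (Suc n)
      note Suc
      also have "p n * (3 / 4 - tail \<rho> (D ^ n * x)) \<le> p n * ((1 - H n) * (3 / 4 - tail \<rho> (D ^ Suc n * x)))"
        by (intro mult_left_mono 1 p0)
      finally show ?case by (simp add: p_def mult.assoc)
    qed (simp add: p_def)
    from this[of n] have "1 / 2 \<le> p n * (3 / 4 - tail \<rho> (D ^ n * x))" using tail by simp
    also have "\<dots> \<le> p n * 1" by (intro mult_left_mono p0) (simp add: algebra_simps add_increasing2)
    finally show ?thesis by simp
  qed
  \<comment> \<open>The step inequality unrolled \<open>n\<close> times; the nonnegative remainder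
    \<open>p n * F \<phi> n\<close> is dropped afterwards.\<close>
  have "(\<Sum>j<n. ennreal (3 / 4 * p j) * h \<phi> j) + ennreal (p n) * F \<phi> n \<le> F \<phi> 0" for n
  proof (induction n)
    case (Suc n)
    have "(\<Sum>j<Suc n. ennreal (3 / 4 * p j) * h \<phi> j) + ennreal (p (Suc n)) * F \<phi> (Suc n)
        = (\<Sum>j<n. ennreal (3 / 4 * p j) * h \<phi> j) + ennreal (p n) * (ennreal (3 / 4) * h \<phi> n + ennreal (1 - H n) * F \<phi> (Suc n))"
    proof -
      have "0 \<le> p n" using p_ge[of n] by simp
      then have "ennreal (3 / 4 * p n) = ennreal (p n) * ennreal (3 / 4)"
        by (subst ennreal_mult[symmetric]) (auto simp: mult.commute)
      moreover have "ennreal (p (Suc n)) = ennreal (p n) * ennreal (1 - H n)"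
        using \<open>0 \<le> p n\<close> H[of n] by (subst ennreal_mult[symmetric]) (auto simp: p_def)
      ultimately show ?thesis by (simp add: distrib_left ac_simps del: ennreal_mult'')
    qed
    also have "\<dots> \<le> (\<Sum>j<n. ennreal (3 / 4 * p j) * h \<phi> j) + ennreal (p n) * F \<phi> n"
      by (intro add_left_mono mult_left_mono step \<phi>) auto
    also note Suc
    finally show ?case .
  qed (simp add: p_def)
  from this[of n] have "(\<Sum>j<n. ennreal (3 / 4 * p j) * h \<phi> j) \<le> F \<phi> 0"
    by (rule order_trans[rotated]) simp
  \<comment> \<open>The constant is 3/4 times the lower bound 1/2 for \<open>p j\<close>.\<close>
  moreover have "ennreal (3 / 8) * (\<Sum>j<n. h \<phi> j) \<le> (\<Sum>j<n. ennreal (3 / 4 * p j) * h \<phi> j)"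
    unfolding sum_distrib_left
    by (intro sum_mono mult_right_mono ennreal_leI) (use p_ge in \<open>auto simp: mult.commute\<close>)
  moreover have "F \<phi> 0 \<le> (\<integral>\<^sup>+y. \<phi> (norm y) \<partial>meas \<rho>)"
    unfolding F_def by (intro nn_integral_mono) (auto simp: indicator_def)
  ultimately show ?thesis by (simp add: h_def D_def)
qed

text \<open>About \<open>log r\<close> of the summands are of order \<open>(log r)\<^sup>k\<close>, namely those with \<open>D\<^sup>j \<le> r\<^sup>1\<^sup>/\<^sup>4\<close>.\<close>

lemma logp_power_le_sum:
  fixes D x0 :: real
  assumes D: "1 < D" and x0: "0 < x0"
  obtains C C' where "0 \<le> C" "0 \<le> C'" "\<And>r. 0 \<le> r \<Longrightarrow> \<exists>n. logp r ^ Suc k \<le>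
    C + C' * (\<Sum>j<n. if 2 * (D ^ j * x0) < r then logp (r / (2 * D ^ j)) ^ k else 0)"
proof -
  \<comment> \<open>For \<open>l > L0\<close> both \<open>ln 2 < l / 4\<close> and
    \<open>\<bar>ln (2 * x0)\<bar> < l / 2\<close> hold. Together with
    \<open>real j * ln D \<le> l / 4\<close> this puts the threshold of summand \<open>j\<close>
    below \<open>r\<close> and leaves at least \<open>l / 2\<close> of the logarithm.\<close>
  define L0 where "L0 = max (4 * ln 2) (2 * \<bar>ln (2 * x0)\<bar> + 1)"
  define C' where "C' = 2 ^ k * (4 * ln D)"
  have lnD: "0 < ln D" using D by simp
  have L0: "0 < L0" by (simp add: L0_def less_max_iff_disj)
  have "\<exists>n. logp r ^ Suc k \<le> L0 ^ Suc k + C' * (\<Sum>j<n. if 2 * (D ^ j * x0) < r then logp (r / (2 * D ^ j)) ^ k else 0)"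
    if r: "0 \<le> r" for r
  proof (cases "logp r \<le> L0")
    case True
    then have "logp r ^ Suc k \<le> L0 ^ Suc k" by (intro power_mono) auto
    then show ?thesis by (intro exI[of _ 0]) simp
  next
    case False
    define l where "l = logp r"
    have l: "L0 < l" using False by (simp add: l_def)
    then have "0 < l" using L0 by linarith
    then have lr: "l = ln r" by (auto simp: l_def logp_def max_def split: if_splits)
    have r0: "0 < r" using \<open>0 < l\<close> r unfolding lr by (cases "r = 0") auto
    \<comment> \<open>With \<open>Suc\<close> there are at least \<open>l / (4 * ln D)\<close>
      summands, while every \<open>j < n\<close> still satisfies
      \<open>real j \<le> l / (4 * ln D)\<close>.\<close>
    define n where "n = Suc (nat \<lfloor>l / (4 * ln D)\<rfloor>)"
    have n: "l / (4 * ln D) \<le> real n"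
      using \<open>0 < l\<close> lnD unfolding n_def by linarith
    have summand: "(l / 2) ^ k \<le> (if 2 * (D ^ j * x0) < r then logp (r / (2 * D ^ j)) ^ k else 0)" if "j < n" for j
    proof -
      have "real j \<le> l / (4 * ln D)"
        using that \<open>0 < l\<close> lnD unfolding n_def
        by (metis less_Suc_eq_le zero_le_divide_iff le_nat_iff le_floor_iff of_int_of_nat_eq less_imp_le mult_nonneg_nonneg zero_le_numeral zero_le_floor)
      then have j: "real j * ln D \<le> l / 4" using lnD by (simp add: field_simps)
      have "ln (2 * (D ^ j * x0)) = ln (2 * x0) + real j * ln D"
        using D x0 by (simp add: ln_mult ln_realpow)
      also have "\<dots> < l" using j l unfolding L0_def by linarith
      finally have 1: "2 * (D ^ j * x0) < r" unfolding lr using r0 D x0 by simp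
      have "l / 2 \<le> l - ln 2 - real j * ln D" using j l unfolding L0_def by linarith
      also have "\<dots> = ln (r / (2 * D ^ j))"
        using D r0 by (simp add: lr ln_div ln_mult ln_realpow)
      also have "\<dots> \<le> logp (r / (2 * D ^ j))" by (simp add: logp_def)
      finally show ?thesis using 1 \<open>0 < l\<close> by (simp add: power_mono)
    qed
    have "logp r ^ Suc k = C' * (l / (4 * ln D) * (l / 2) ^ k)"
      using lnD by (simp add: C'_def l_def power_divide)
    also have "\<dots> \<le> C' * (real n * (l / 2) ^ k)"
      using n \<open>0 < l\<close> lnD by (intro mult_left_mono mult_right_mono) (auto simp: C'_def)
    also have "real n * (l / 2) ^ k = (\<Sum>j<n. (l / 2) ^ k)" by simp
    also have "C' * \<dots> \<le> C' * (\<Sum>j<n. if 2 * (D ^ j * x0) < r then logp (r / (2 * D ^ j)) ^ k else 0)"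
      using lnD by (intro mult_left_mono sum_mono summand) (auto simp: C'_def)
    finally show ?thesis
      using L0 by (intro exI[of _ n]) (simp add: add_increasing)
  qed
  then show ?thesis
    using L0 lnD by (intro that[of "L0 ^ Suc k" C']) (auto simp: C'_def)
qed

text \<open>With \<open>\<phi>\<close> the \<open>k\<close>-th power of \<open>logp\<close>, the
  moment of \<open>\<rho>\<close> bounds the \<open>\<mu>\<close>-integral of a sum over all scales,
  and by \<open>logp_power_le_sum\<close> that sum dominates the next power up to constants. For
  \<open>k = 0\<close> the moment hypothesis is trivial, so every law \<open>\<mu>\<close> with a
  fixed point has a logarithmic moment of order 1.\<close>

lemma log_moment_Suc_if_fixpoint:
  fixes \<mu> \<rho> :: "'a::ordered_euclidean_space law"
  assumes \<rho>: "\<rho> = \<mu> + lscale (1 / b) \<rho>" and b: "1 < b" and mom: "log_moment k \<rho>"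
  shows "log_moment (Suc k) \<mu>"
proof -
  interpret \<mu>: prob_space "meas \<mu>" by simp
  obtain x where x: "0 < x" "tail \<rho> x \<le> 1 / 4"
  proof -
    have "\<forall>\<^sub>F x in at_top. tail \<rho> x < 1 / 4"
      using tail_tendsto_0 by (rule order_tendstoD) simp
    then have "\<forall>\<^sub>F x in at_top. 0 < x \<and> tail \<rho> x < 1 / 4"
      using eventually_gt_at_top[of 0] by eventually_elim simp
    then obtain x where "0 < x \<and> tail \<rho> x < 1 / 4"
      using eventually_happens'[OF trivial_limit_at_top_linorder] by blast
    then show ?thesis by (intro that[of x]) auto
  qed
  define D where "D = 3 * b"
  define \<phi> where "\<phi> r = ennreal (logp r ^ k)" for r
  have [measurable]: "\<phi> \<in> borel_measurable borel" unfolding \<phi>_def[abs_def] by measurable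
  have \<phi>_mono: "\<phi> r \<le> \<phi> s" if "0 \<le> r" "r \<le> s" for r s
    using logp_mono[OF that] by (auto simp: \<phi>_def intro!: ennreal_leI power_mono)
  define S where "S r = (\<Sum>j. \<phi> (r / (2 * D ^ j)) * indicator {r. 2 * (D ^ j * x) < r} r)" for r
  have sums: "ennreal (3 / 8) * (\<Sum>j<n. \<integral>\<^sup>+u. \<phi> (norm u / (2 * D ^ j)) * indicator {r. 2 * (D ^ j * x) < r} (norm u) \<partial>meas \<mu>)
      \<le> (\<integral>\<^sup>+y. \<phi> (norm y) \<partial>meas \<rho>)" for n
    using lscale_fixpoint_sum_le[OF \<rho> b x, where \<phi> = \<phi> and n = n, OF \<phi>_mono] by (simp add: D_def indicator_def)
  have "(\<integral>\<^sup>+u. S (norm u) \<partial>meas \<mu>) = (\<Sum>j. \<integral>\<^sup>+u. \<phi> (norm u / (2 * D ^ j)) * indicator {r. 2 * (D ^ j * x) < r} (norm u) \<partial>meas \<mu>)"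
    unfolding S_def by (rule nn_integral_suminf) simp
  also have "ennreal (3 / 8) * \<dots> \<le> (\<integral>\<^sup>+y. \<phi> (norm y) \<partial>meas \<rho>)"
    unfolding ennreal_suminf_cmult[symmetric]
    by (rule suminf_le_const) (simp_all add: sums sum_distrib_left[symmetric])
  also have "\<dots> < \<infinity>" using mom by (simp add: log_moment_def \<phi>_def)
  finally have S_fin: "(\<integral>\<^sup>+u. S (norm u) \<partial>meas \<mu>) < \<infinity>"
    by (auto simp: ennreal_mult_less_top)
  obtain C C' where C: "0 \<le> C" "0 \<le> C'" "\<And>r. 0 \<le> r \<Longrightarrow> \<exists>n. logp r ^ Suc k \<le>
    C + C' * (\<Sum>j<n. if 2 * (D ^ j * x) < r then logp (r / (2 * D ^ j)) ^ k else 0)"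
    using logp_power_le_sum[where D = D and ?x0.0 = x and k = k] b x unfolding D_def by auto
  have bound: "ennreal (logp r ^ Suc k) \<le> ennreal C + ennreal C' * S r" if r: "0 \<le> r" for r
  proof -
    obtain n where n: "logp r ^ Suc k \<le>
      C + C' * (\<Sum>j<n. if 2 * (D ^ j * x) < r then logp (r / (2 * D ^ j)) ^ k else 0)"
      using C(3)[OF r] by blast
    have "ennreal (logp r ^ Suc k) \<le>
      ennreal (C + C' * (\<Sum>j<n. if 2 * (D ^ j * x) < r then logp (r / (2 * D ^ j)) ^ k else 0))"
      using n by (rule ennreal_leI)
    also have "\<dots> = ennreal C + ennreal C' * (\<Sum>j<n. \<phi> (r / (2 * D ^ j)) * indicator {r. 2 * (D ^ j * x) < r} r)"
    proof -
      have "(\<Sum>j<n. \<phi> (r / (2 * D ^ j)) * indicator {r. 2 * (D ^ j * x) < r} r)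
          = ennreal (\<Sum>j<n. if 2 * (D ^ j * x) < r then logp (r / (2 * D ^ j)) ^ k else 0)"
        unfolding \<phi>_def by (subst sum_ennreal[symmetric], simp, rule sum.cong) (simp_all split: split_indicator)
      then show ?thesis using C(1,2) by (simp add: ennreal_plus ennreal_mult sum_nonneg)
    qed
    also have "\<dots> \<le> ennreal C + ennreal C' * S r"
      unfolding S_def by (intro add_left_mono mult_left_mono sum_le_suminf) auto
    finally show ?thesis .
  qed
  have "(\<integral>\<^sup>+u. ennreal (logp (norm u) ^ Suc k) \<partial>meas \<mu>) \<le> (\<integral>\<^sup>+u. ennreal C + ennreal C' * S (norm u) \<partial>meas \<mu>)"
    by (intro nn_integral_mono bound) simp
  also have "\<dots> = ennreal C + ennreal C' * (\<integral>\<^sup>+u. S (norm u) \<partial>meas \<mu>)"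
    unfolding S_def using \<mu>.emeasure_space_1
    by (subst nn_integral_add) (auto simp: nn_integral_cmult)
  also have "\<dots> < \<infinity>" using S_fin by (simp add: ennreal_mult_less_top)
  finally show ?thesis by (simp add: log_moment_def)
qed

section \<open>Almost sure convergence\<close>

lemma summable_poly_geometric:
  fixes z :: real
  assumes z: "0 < z" "z < 1"
  shows "summable (\<lambda>n. real (Suc n) ^ m * z ^ n)"
proof -
  have "(\<lambda>n. (1 + 1 / real (Suc n)) ^ m * z) \<longlonglongrightarrow> (1 + 0) ^ m * z"
    by (intro tendsto_intros LIMSEQ_Suc[OF lim_1_over_n])
  then have "\<forall>\<^sub>F n in sequentially. (1 + 1 / real (Suc n)) ^ m * z < (1 + z) / 2"
    using z by (intro order_tendstoD) auto
  then obtain N where N: "\<And>n. N \<le> n \<Longrightarrow> (1 + 1 / real (Suc n)) ^ m * z < (1 + z) / 2"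
    by (auto simp: eventually_sequentially)
  show ?thesis
  proof (rule summable_ratio_test)
    show "(1 + z) / 2 < 1" using z by simp
    fix n assume "N \<le> n"
    have "real (Suc (Suc n)) = (1 + 1 / real (Suc n)) * real (Suc n)"
      by (simp add: field_simps)
    then have "norm (real (Suc (Suc n)) ^ m * z ^ Suc n) = ((1 + 1 / real (Suc n)) ^ m * z) * norm (real (Suc n) ^ m * z ^ n)"
      using z by (simp add: power_mult_distrib)
    also have "\<dots> \<le> (1 + z) / 2 * norm (real (Suc n) ^ m * z ^ n)"
      using N[OF \<open>N \<le> n\<close>] by (intro mult_right_mono) auto
    finally show "norm (real (Suc (Suc n)) ^ m * z ^ Suc n) \<le> (1 + z) / 2 * norm (real (Suc n) ^ m * z ^ n)" .
  qed
qed

lemma (in prob_space) tendsto_prob_if_AE_tendsto: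
  fixes Z :: "nat \<Rightarrow> 'a \<Rightarrow> 'b::ordered_euclidean_space"
  assumes [measurable]: "\<And>n. Z n \<in> borel_measurable M" "Y \<in> borel_measurable M"
    and lim: "AE \<omega> in M. (\<lambda>n. Z n \<omega>) \<longlonglongrightarrow> Y \<omega>" and e: "0 < e"
  shows "(\<lambda>n. prob {\<omega> \<in> space M. e < dist (Z n \<omega>) (Y \<omega>)}) \<longlonglongrightarrow> 0"
proof -
  let ?S = "\<lambda>n. {\<omega> \<in> space M. e < dist (Z n \<omega>) (Y \<omega>)}"
  have "(\<lambda>n. \<integral>\<omega>. indicator (?S n) \<omega> \<partial>M) \<longlonglongrightarrow> (\<integral>\<omega>. 0 \<partial>M :: real)"
  proof (rule integral_dominated_convergence[where w = "\<lambda>_. 1"])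
    show "AE \<omega> in M. (\<lambda>n. indicator (?S n) \<omega>) \<longlonglongrightarrow> (0 :: real)"
      using lim
    proof eventually_elim
      case (elim \<omega>)
      then have "\<forall>\<^sub>F n in sequentially. dist (Z n \<omega>) (Y \<omega>) < e" using e by (rule tendstoD)
      then have "\<forall>\<^sub>F n in sequentially. indicator (?S n) \<omega> = (0 :: real)"
        by eventually_elim (auto simp: indicator_def)
      then show ?case by (rule tendsto_eventually)
    qed
  qed (auto intro!: borel_measurable_indicator)
  then show ?thesis by simp
qed

text \<open>Borel-Cantelli with thresholds \<open>N j * c ^ j\<close>, where \<open>c\<close> is the
  square root of \<open>b\<close>. By \<open>tail_nmul\<close> the exceptional probabilities are
  summable under the moment of order \<open>Suc m\<close>. Outside them the terms are at most
  \<open>Suc j ^ m * (c / b) ^ j\<close>, and \<open>c / b = 1 / c\<close> is still below 1.\<close>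

lemma (in prob_space) AE_summable_blocks:
  fixes V :: "nat \<Rightarrow> 'a \<Rightarrow> 'b::ordered_euclidean_space"
  assumes b: "1 < b" and [measurable]: "\<And>j. V j \<in> borel_measurable M"
    and V: "\<And>j. law M (V j) = nmul (N j) \<mu>" and N: "\<And>j. N j \<le> Suc j ^ m"
    and mom: "log_moment (Suc m) \<mu>"
  shows "AE \<omega> in M. summable (\<lambda>j. norm ((1 / b) ^ j *\<^sub>R V j \<omega>))"
proof -
  define c where "c = sqrt b"
  have c: "1 < c" "c * c = b" using b by (simp_all add: c_def)
  define A where "A j = {\<omega> \<in> space M. real (N j) * c ^ j < norm (V j \<omega>)}" for j
  have [measurable]: "A j \<in> sets M" for j by (simp add: A_def)
  have "prob (A j) \<le> real (N j) * tail \<mu> (c ^ j)" for j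
    using tail_nmul[of "N j" \<mu> "c ^ j"] by (simp add: tail_law[of "V j", symmetric] A_def V)
  then have "summable (\<lambda>j. prob (A j))"
    by (intro summable_comparison_test'[OF log_moment_tail_summable[OF mom c(1) N]]) simp
  then have "AE \<omega> in M. \<forall>\<^sub>F j in sequentially. \<omega> \<in> space M - A j"
    by (intro borel_cantelli_AE1) (auto simp: emeasure_eq_measure)
  then show ?thesis
  proof eventually_elim
    case (elim \<omega>)
    show ?case
    proof (rule summable_comparison_test_ev)
      show "summable (\<lambda>j. real (Suc j) ^ m * (1 / c) ^ j)"
        using c by (intro summable_poly_geometric) auto
      show "\<forall>\<^sub>F j in sequentially. norm (norm ((1 / b) ^ j *\<^sub>R V j \<omega>)) \<le> real (Suc j) ^ m * (1 / c) ^ j"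
        using elim
      proof eventually_elim
        case (elim j)
        have "norm (V j \<omega>) \<le> real (N j) * c ^ j" using elim by (auto simp: A_def)
        also have "\<dots> \<le> real (Suc j ^ m) * c ^ j" using N[of j] c by (intro mult_right_mono of_nat_mono) auto
        finally have "(1 / b) ^ j * norm (V j \<omega>) \<le> (1 / b) ^ j * (real (Suc j ^ m) * c ^ j)"
          using b by (intro mult_left_mono) auto
        also have "\<dots> = real (Suc j) ^ m * (c / b) ^ j" by (simp add: power_divide)
        also have "c / b = 1 / c" using c by (auto simp: field_simps)
        finally show ?case using b by simp
      qed
    qed
  qed
qed

text \<open>A term vanishes as soon as \<open>c ^ j\<close> reaches \<open>r\<close>, so about
  logarithmically many terms remain. The exponent is \<open>Suc k\<close> because for exponent 0
  every term would be 1.\<close>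

lemma sum_logp_scaled_le:
  assumes c: "1 < c" and r: "0 \<le> r"
  shows "(\<Sum>j. ennreal (logp (r / c ^ j) ^ Suc k)) \<le> ennreal ((logp r / ln c + 1) * logp r ^ Suc k)"
proof -
  define l where "l = logp r / ln c"
  have l: "0 \<le> l" using c by (simp add: l_def)
  define n where "n = nat \<lceil>l\<rceil>"
  have zero: "logp (r / c ^ j) = 0" if "n \<le> j" for j
  proof (rule ccontr)
    assume "logp (r / c ^ j) \<noteq> 0"
    then have ln: "0 < ln (r / c ^ j)" by (auto simp: logp_def max_def split: if_splits)
    have "0 < r" using r ln by (cases "r = 0") auto
    then have "0 < r / c ^ j" using c by simp
    then have "1 < r / c ^ j" using ln by simp
    then have "c ^ j < r" using c by (simp add: field_simps)
    then have "real j < l" unfolding l_def by (rule less_logp_if_power_less[OF c])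
    then show False using that by (simp add: n_def nat_le_iff ceiling_le_iff)
  qed
  have "(\<Sum>j. ennreal (logp (r / c ^ j) ^ Suc k)) = (\<Sum>j<n. ennreal (logp (r / c ^ j) ^ Suc k))"
    by (rule suminf_finite) (auto simp: zero not_less)
  also have "\<dots> \<le> (\<Sum>j<n. ennreal (logp r ^ Suc k))"
  proof (rule sum_mono)
    fix j
    have "logp (r / c ^ j) \<le> logp r"
    proof (rule logp_mono)
      have "r / c ^ j \<le> r / 1" using c r by (intro divide_left_mono) auto
      then show "r / c ^ j \<le> r" by simp
    qed (use c r in simp)
    then show "ennreal (logp (r / c ^ j) ^ Suc k) \<le> ennreal (logp r ^ Suc k)"
      by (intro ennreal_leI power_mono) auto
  qed
  also have "\<dots> = ennreal (real n * logp r ^ Suc k)"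
    by (subst sum_ennreal) auto
  also have "\<dots> \<le> ennreal ((l + 1) * logp r ^ Suc k)"
    using l unfolding n_def by (intro ennreal_leI mult_right_mono) (linarith | simp)+
  finally show ?thesis by (simp add: l_def)
qed

text \<open>A bound on the single number \<open>W \<omega>\<close> controls all summands at once: if
  \<open>q ^ k = W \<omega>\<close>, then every \<open>norm (V j \<omega>)\<close> is at most
  \<open>c ^ j * exp q\<close>, so the series is at most a constant times \<open>exp q\<close> and
  its \<open>k\<close>-th logarithmic power is of order \<open>W \<omega>\<close>. The expectation
  of \<open>W\<close> costs one additional logarithm of \<open>\<mu>\<close>.\<close>

lemma (in prob_space) log_moment_law_suminf:
  fixes V :: "nat \<Rightarrow> 'a \<Rightarrow> 'b::ordered_euclidean_space"
  assumes b: "1 < b" and [measurable]: "\<And>j. V j \<in> borel_measurable M"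
    and V: "\<And>j. law M (V j) = \<mu>" and mom: "log_moment (Suc k) \<mu>"
    and sm: "AE \<omega> in M. summable (\<lambda>j. norm ((1 / b) ^ j *\<^sub>R V j \<omega>))"
  shows "log_moment k (law M (\<lambda>\<omega>. \<Sum>j. (1 / b) ^ j *\<^sub>R V j \<omega>))"
proof (cases k)
  case 0
  interpret Y: prob_space "meas (law M (\<lambda>\<omega>. \<Sum>j. (1 / b) ^ j *\<^sub>R V j \<omega>))" by simp
  show ?thesis using 0 Y.emeasure_space_1 by (simp add: log_moment_def)
next
  case (Suc i)
  define c where "c = sqrt b"
  have c: "1 < c" "c * c = b" using b by (simp_all add: c_def)
  \<comment> \<open>The sum of the geometric series with ratio \<open>c / b = 1 / c\<close>.\<close>
  define G where "G = 1 / (1 - 1 / c)"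
  have G: "1 \<le> G" using c by (simp add: G_def field_simps)
  define Y where "Y \<omega> = (\<Sum>j. (1 / b) ^ j *\<^sub>R V j \<omega>)" for \<omega>
  have [measurable]: "Y \<in> borel_measurable M" unfolding Y_def[abs_def] by measurable
  define W where "W \<omega> = (\<Sum>j. ennreal (logp (norm (V j \<omega>) / c ^ j) ^ k))" for \<omega>
  have [measurable]: "W \<in> borel_measurable M" unfolding W_def[abs_def] by measurable
  interpret \<mu>: prob_space "meas \<mu>" by simp
  have "(\<integral>\<^sup>+\<omega>. W \<omega> \<partial>M) = (\<Sum>j. \<integral>\<^sup>+\<omega>. ennreal (logp (norm (V j \<omega>) / c ^ j) ^ k) \<partial>M)"
    unfolding W_def by (rule nn_integral_suminf) simp
  also have "\<dots> = (\<Sum>j. \<integral>\<^sup>+x. ennreal (logp (norm x / c ^ j) ^ k) \<partial>meas \<mu>)"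
    by (subst nn_integral_law[symmetric, where f = "\<lambda>x. ennreal (logp (norm x / c ^ _) ^ k)"]) (simp_all add: V)
  also have "\<dots> = (\<integral>\<^sup>+x. (\<Sum>j. ennreal (logp (norm x / c ^ j) ^ k)) \<partial>meas \<mu>)"
    by (rule nn_integral_suminf[symmetric]) simp
  also have "\<dots> \<le> (\<integral>\<^sup>+x. ennreal ((logp (norm x) / ln c + 1) * logp (norm x) ^ k) \<partial>meas \<mu>)"
    unfolding Suc by (intro nn_integral_mono sum_logp_scaled_le c) simp
  also have "\<dots> < \<infinity>"
  proof -
    have "integrable (meas \<mu>) (\<lambda>x. logp (norm x) ^ Suc k / ln c + logp (norm x) ^ k)"
      using mom log_moment_Suc_imp[OF mom] by (simp add: log_moment_iff_integrable del: power_Suc)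
    then have "integrable (meas \<mu>) (\<lambda>x. (logp (norm x) / ln c + 1) * logp (norm x) ^ k)"
      by (simp add: distrib_right)
    then show ?thesis using c by (subst nn_integral_eq_integral) auto
  qed
  finally have W_fin: "(\<integral>\<^sup>+\<omega>. W \<omega> \<partial>M) < \<infinity>" .
  have bound: "AE \<omega> in M. ennreal (logp (norm (Y \<omega>)) ^ k) \<le> ennreal (2 ^ k * ln G ^ k) + ennreal (2 ^ k) * W \<omega>"
    using sm
  proof eventually_elim
    case (elim \<omega>)
    show ?case
    proof (cases "W \<omega> = \<infinity>")
      case False
      then obtain w where w: "W \<omega> = ennreal w" "0 \<le> w" by (cases "W \<omega>") auto
      define q where "q = root k w"
      have q: "0 \<le> q" "q ^ k = w" using w Suc real_root_pow_pos2[of k w] by (simp_all add: q_def del: power_Suc)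
      have V_le: "norm (V j \<omega>) \<le> c ^ j * exp q" for j
      proof -
        have "(\<Sum>j\<in>{j}. ennreal (logp (norm (V j \<omega>) / c ^ j) ^ k)) \<le> W \<omega>"
          unfolding W_def by (rule sum_le_suminf) auto
        then have "logp (norm (V j \<omega>) / c ^ j) ^ k \<le> q ^ k" using w q by simp
        then have "logp (norm (V j \<omega>) / c ^ j) \<le> q"
          using q Suc by (subst (asm) power_mono_iff) auto
        then have ln_le: "ln (norm (V j \<omega>) / c ^ j) \<le> q" by (simp add: logp_def)
        have "norm (V j \<omega>) / c ^ j \<le> exp q"
        proof (cases "norm (V j \<omega>) = 0")
          case False
          then have "0 < norm (V j \<omega>) / c ^ j" using c by simp
          then show ?thesis using ln_le by (metis exp_le_cancel_iff exp_ln)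
        qed simp
        then show ?thesis using c by (simp add: field_simps)
      qed
      have Y_le: "norm (Y \<omega>) \<le> G * exp q"
      proof -
        have sg: "(\<lambda>j. (1 / c) ^ j * exp q) sums (G * exp q)"
          unfolding G_def using c by (intro sums_mult2 geometric_sums) auto
        have "norm (Y \<omega>) \<le> (\<Sum>j. norm ((1 / b) ^ j *\<^sub>R V j \<omega>))"
          unfolding Y_def by (rule summable_norm[OF elim])
        also have "\<dots> \<le> (\<Sum>j. (1 / c) ^ j * exp q)"
        proof (rule suminf_le[OF _ elim sums_summable[OF sg]])
          fix j
          have "norm ((1 / b) ^ j *\<^sub>R V j \<omega>) = (1 / b) ^ j * norm (V j \<omega>)" using b by simp
          also have "\<dots> \<le> (1 / b) ^ j * (c ^ j * exp q)" using b by (intro mult_left_mono V_le) auto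
          also have "\<dots> = (c / b) ^ j * exp q" by (simp add: power_divide)
          also have "c / b = 1 / c" using c by (auto simp: field_simps)
          finally show "norm ((1 / b) ^ j *\<^sub>R V j \<omega>) \<le> (1 / c) ^ j * exp q" .
        qed
        also have "\<dots> = G * exp q" using sg by (rule sums_unique[symmetric])
        finally show ?thesis .
      qed
      have "logp (norm (Y \<omega>)) \<le> logp (G * exp q)" using Y_le by (intro logp_mono) auto
      also have "logp (G * exp q) = ln G + q" using G q by (simp add: logp_def ln_mult)
      finally have "logp (norm (Y \<omega>)) ^ k \<le> (ln G + q) ^ k" by (intro power_mono) auto
      also have "\<dots> \<le> 2 ^ k * (ln G ^ k + q ^ k)" using G q by (intro power_add_le) auto
      finally have "ennreal (logp (norm (Y \<omega>)) ^ k) \<le> ennreal (2 ^ k * ln G ^ k + 2 ^ k * w)"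
        using q by (intro ennreal_leI) (simp add: distrib_left)
      then show ?thesis using G w by (simp add: ennreal_plus ennreal_mult)
    qed (simp add: ennreal_mult_top)
  qed
  have "(\<integral>\<^sup>+\<omega>. ennreal (logp (norm (Y \<omega>)) ^ k) \<partial>M) \<le> (\<integral>\<^sup>+\<omega>. ennreal (2 ^ k * ln G ^ k) + ennreal (2 ^ k) * W \<omega> \<partial>M)"
    by (rule nn_integral_mono_AE[OF bound])
  also have "\<dots> = ennreal (2 ^ k * ln G ^ k) + ennreal (2 ^ k) * (\<integral>\<^sup>+\<omega>. W \<omega> \<partial>M)"
    by (subst nn_integral_add) (auto simp: nn_integral_cmult emeasure_space_1)
  also have "\<dots> < \<infinity>" using W_fin by (auto simp: ennreal_mult_less_top)
  finally show ?thesis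
    unfolding log_moment_def Y_def[symmetric] by (subst nn_integral_law) auto
qed

text \<open>The coordinates of an infinite product. A Levy family supplies such sequences only for
  infinitely divisible laws, whereas fixed points are also required for convolution roots, whose
  infinite divisibility is not established here.\<close>

lemma exists_iid:
  fixes \<mu> :: "'a::ordered_euclidean_space law"
  defines "M \<equiv> PiM (UNIV :: nat set) (\<lambda>_. meas \<mu>)"
  shows "prob_space M" "\<And>j. (\<lambda>\<omega>. \<omega> j) \<in> borel_measurable M" "\<And>j. law M (\<lambda>\<omega>. \<omega> j) = \<mu>"
    "prob_space.indep_vars M (\<lambda>_. borel) (\<lambda>j \<omega>. \<omega> j) UNIV"
proof -
  show M: "prob_space M" unfolding M_def by (rule prob_space_PiM) simp
  interpret prob_space M by (rule M)
  have meas: "(\<lambda>\<omega>. \<omega> j) \<in> M \<rightarrow>\<^sub>M meas \<mu>" for j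
    unfolding M_def by (rule measurable_component_singleton) simp
  then show meas_b: "(\<lambda>\<omega>. \<omega> j) \<in> borel_measurable M" for j
    by (simp cong: measurable_cong_sets)
  have "distr M (meas \<mu>) (\<lambda>\<omega>. \<omega> j) = meas \<mu>" for j
    unfolding M_def by (rule distr_PiM_component) auto
  then have distr: "distr M borel (\<lambda>\<omega>. \<omega> j) = meas \<mu>" for j
    by (metis distr_cong sets_meas)
  then show "law M (\<lambda>\<omega>. \<omega> j) = \<mu>" for j
    by (simp add: law_def meas_inverse)
  have sets_M: "sets M = sets (PiM UNIV (\<lambda>_. borel))"
    unfolding M_def by (rule sets_PiM_cong) auto
  have "distr M (PiM UNIV (\<lambda>_. borel)) (\<lambda>\<omega>. \<lambda>j\<in>UNIV. \<omega> j) = M"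
    by (simp add: restrict_UNIV distr_id2 sets_M)
  also have "M = PiM UNIV (\<lambda>j. distr M borel (\<lambda>\<omega>. \<omega> j))"
    unfolding distr by (rule M_def[THEN meta_eq_to_obj_eq])
  finally show "indep_vars (\<lambda>_. borel) (\<lambda>j \<omega>. \<omega> j) UNIV"
    by (subst indep_vars_iff_distr_eq_PiM') (simp_all add: meas_b)
qed

section \<open>Iterated block sums\<close>

lemma binomial_le_Suc_power: "(j + m) choose m \<le> Suc j ^ m"
proof (induction m)
  case (Suc m)
  have "((j + Suc m) choose Suc m) * Suc m = Suc (j + m) * ((j + m) choose m)"
    using Suc_times_binomial_eq[of "j + m" m] by simp
  \<comment> \<open>This rests on \<open>Suc (j + m) \<le> Suc j * Suc m\<close>.\<close>
  also have "\<dots> \<le> (Suc j * Suc m) * Suc j ^ m"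
    using Suc by (intro mult_mono) auto
  also have "\<dots> = Suc j ^ Suc m * Suc m" by (simp only: power_Suc ac_simps)
  finally show ?case by (simp only: mult_le_cancel2) 
qed simp

definition block_sum :: "real \<Rightarrow> nat \<Rightarrow> 'a::ordered_euclidean_space law \<Rightarrow> nat \<Rightarrow> 'a law" where
  "block_sum b m A n = (\<Sum>j<n. lscale ((1 / b) ^ j) (nmul ((j + m) choose m) A))"

text \<open>Uniformity in \<open>N\<close> is what the control inside a block requires, where the
  number of complete unit steps depends on the time. Half of the geometric rate of \<open>b\<close>
  serves as the threshold per copy, the other half absorbs the number of copies.\<close>

lemma tail_nmul_le_eventually:
  assumes A: "log_moment k A" and b: "1 < b" and e: "0 < e" "0 < \<eta>"
  shows "\<forall>\<^sub>F n in sequentially. \<forall>N \<le> Suc n ^ k. tail (nmul N A) (e * b ^ n) < \<eta>"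
proof -
  define c where "c = sqrt b"
  have c: "1 < c" "c * c = b" using b by (simp_all add: c_def)
  have "(\<lambda>n. real (Suc n) ^ k * (1 / c) ^ n) \<longlonglongrightarrow> 0"
    using c by (intro summable_LIMSEQ_zero summable_poly_geometric) auto
  then have "\<forall>\<^sub>F n in sequentially. real (Suc n) ^ k * (1 / c) ^ n < e"
    using e by (intro order_tendstoD)
  moreover have "\<forall>\<^sub>F n in sequentially. real (Suc n) ^ k * tail A (c ^ n) < \<eta>"
    using log_moment_tail_tendsto[OF A c(1)] e by (intro order_tendstoD)
  ultimately show ?thesis
  proof eventually_elim
    case (elim n)
    show ?case
    proof (intro allI impI)
      fix N assume "N \<le> Suc n ^ k"
      then have "real N \<le> real (Suc n ^ k)" by (rule of_nat_mono)
      then have N: "real N \<le> real (Suc n) ^ k" by simp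
      have "real N * c ^ n \<le> real (Suc n) ^ k * c ^ n" using N c by (intro mult_right_mono) auto
      also have "\<dots> = real (Suc n) ^ k * (1 / c) ^ n * b ^ n"
        using c by (auto simp: c(2)[symmetric] power_mult_distrib power_one_over)
      also have "\<dots> \<le> e * b ^ n" using elim(1) b by (intro mult_right_mono) auto
      finally have "tail (nmul N A) (e * b ^ n) \<le> tail (nmul N A) (real N * c ^ n)"
        by (rule tail_antimono)
      also have "\<dots> \<le> real N * tail A (c ^ n)" by (rule tail_nmul)
      also have "\<dots> \<le> real (Suc n) ^ k * tail A (c ^ n)" using N by (intro mult_right_mono) auto
      finally show "tail (nmul N A) (e * b ^ n) < \<eta>" using elim(2) by simp
    qed
  qed
qed

lemma tail_lscale_inverse_power: "1 < b \<Longrightarrow> tail (lscale ((1 / b) ^ n) A) e = tail A (e * b ^ n)"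
  by (subst tail_lscale) (simp_all add: power_one_over)

lemma tail_lscale_nmul_tendsto_0:
  assumes A: "log_moment k A" and b: "1 < b" and e: "0 < e" and N: "\<And>n. N n \<le> Suc n ^ k"
  shows "(\<lambda>n. tail (lscale ((1 / b) ^ n) (nmul (N n) A)) e) \<longlonglongrightarrow> 0"
proof (rule tendstoI)
  fix \<eta> :: real assume "0 < \<eta>"
  from tail_nmul_le_eventually[OF A b e this]
  show "\<forall>\<^sub>F n in sequentially. dist (tail (lscale ((1 / b) ^ n) (nmul (N n) A)) e) 0 < \<eta>"
    by eventually_elim (use N b in \<open>simp add: tail_lscale_inverse_power\<close>)
qed

lemma log_moment_0: "log_moment 0 A"
  using prob_space.emeasure_space_1[OF prob_space_meas, of A] by (simp add: log_moment_def)

section \<open>Existence, uniqueness and moments of the fixed point\<close>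

lemma fixpoint_expand:
  assumes "\<rho> = A + lscale (1 / b) \<rho>"
  shows "\<rho> = (\<Sum>j<n. lscale ((1 / b) ^ j) A) + lscale ((1 / b) ^ n) \<rho>"
proof (induction n)
  case (Suc n)
  have "lscale ((1 / b) ^ n) \<rho> = lscale ((1 / b) ^ n) A + lscale ((1 / b) ^ Suc n) \<rho>"
    by (subst assms) (simp add: lscale_plus lscale_lscale mult.commute)
  then have "(\<Sum>j<n. lscale ((1 / b) ^ j) A) + lscale ((1 / b) ^ n) \<rho>
      = (\<Sum>j<Suc n. lscale ((1 / b) ^ j) A) + lscale ((1 / b) ^ Suc n) \<rho>"
    by (simp add: add.assoc)
  with Suc show ?case by (rule trans)
qed simp

lemma block_sum_0: "block_sum b 0 A n = (\<Sum>j<n. lscale ((1 / b) ^ j) A)"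
  by (simp add: block_sum_def)

text \<open>From left to right the remainder \<open>lscale ((1 / b) ^ n) \<rho>\<close> is
  negligible for any law, since order 0 of \<open>log_moment\<close> is free. From right to left,
  adding \<open>A\<close> to the contracted partial sum merely shifts the index, so both sides are
  limits of one sequence.\<close>

lemma fixpoint_iff_block_sum_tendsto:
  assumes b: "1 < b"
  shows "\<rho> = A + lscale (1 / b) \<rho> \<longleftrightarrow> law_tendsto (block_sum b 0 A) \<rho>"
proof
  assume \<rho>: "\<rho> = A + lscale (1 / b) \<rho>"
  have "law_tendsto (\<lambda>_. \<rho>) \<rho> \<longleftrightarrow> law_tendsto (block_sum b 0 A) \<rho>"
  proof (rule law_tendsto_perturb_iff)
    show "\<rho> = block_sum b 0 A n + lscale ((1 / b) ^ n) \<rho>" for n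
      unfolding block_sum_0 by (rule fixpoint_expand[OF \<rho>])
    show "(\<lambda>n. tail (lscale ((1 / b) ^ n) \<rho>) e) \<longlonglongrightarrow> 0" if "0 < e" for e
      using tail_lscale_nmul_tendsto_0[OF log_moment_0 b that, of "\<lambda>_. 1" \<rho>] by simp
  qed
  then show "law_tendsto (block_sum b 0 A) \<rho>" by (simp add: law_tendsto_const)
next
  assume lim: "law_tendsto (block_sum b 0 A) \<rho>"
  have "law_tendsto (\<lambda>n. A + lscale (1 / b) (block_sum b 0 A n)) (A + lscale (1 / b) \<rho>)"
    by (intro law_tendsto_plus_const law_tendsto_lscale lim)
  also have "(\<lambda>n. A + lscale (1 / b) (block_sum b 0 A n)) = (\<lambda>n. block_sum b 0 A (Suc n))"
    unfolding block_sum_0 sum.lessThan_Suc_shift by (simp add: lscale_sum lscale_lscale)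
  finally have "law_tendsto (\<lambda>n. block_sum b 0 A (Suc n)) (A + lscale (1 / b) \<rho>)" .
  moreover have "law_tendsto (\<lambda>n. block_sum b 0 A (Suc n)) \<rho>"
    using lim unfolding law_tendsto_def by (intro allI impI LIMSEQ_Suc) simp
  ultimately show "\<rho> = A + lscale (1 / b) \<rho>"
    by (rule law_tendsto_unique[rotated])
qed

lemma fixpoint_unique:
  assumes b: "1 < b" and "\<rho> = A + lscale (1 / b) \<rho>" "\<rho>' = A + lscale (1 / b) \<rho>'"
  shows "\<rho> = \<rho>'"
  using assms(2,3) unfolding fixpoint_iff_block_sum_tendsto[OF b] by (rule law_tendsto_unique)

lemma fixpoint_nmul:
  assumes "\<rho> = A + lscale (1 / b) \<rho>"
  shows "nmul n \<rho> = nmul n A + lscale (1 / b) (nmul n \<rho>)"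
proof -
  have "nmul n (A + lscale (1 / b) \<rho>) = nmul n A + lscale (1 / b) (nmul n \<rho>)"
    by (simp only: nmul_plus lscale_nmul)
  then show ?thesis by (simp only: assms[symmetric])
qed

lemma (in prob_space) blocks_converge:
  fixes V :: "nat \<Rightarrow> 'a \<Rightarrow> 'b::ordered_euclidean_space"
  assumes b: "1 < b" and V_meas [measurable]: "\<And>j. V j \<in> borel_measurable M"
    and V: "\<And>j. law M (V j) = nmul ((j + m) choose m) A"
    and mom: "log_moment (Suc m) A" and e: "0 < e"
  shows "(\<lambda>n. prob {\<omega> \<in> space M. e < dist (\<Sum>j<n. (1 / b) ^ j *\<^sub>R V j \<omega>) (\<Sum>j. (1 / b) ^ j *\<^sub>R V j \<omega>)}) \<longlonglongrightarrow> 0"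
proof (rule tendsto_prob_if_AE_tendsto[OF _ _ _ e])
  have "AE \<omega> in M. summable (\<lambda>j. norm ((1 / b) ^ j *\<^sub>R V j \<omega>))"
    by (rule AE_summable_blocks[OF b V_meas V binomial_le_Suc_power mom])
  then show "AE \<omega> in M. (\<lambda>n. \<Sum>j<n. (1 / b) ^ j *\<^sub>R V j \<omega>) \<longlonglongrightarrow> (\<Sum>j. (1 / b) ^ j *\<^sub>R V j \<omega>)"
  proof eventually_elim
    case (elim \<omega>)
    show ?case by (rule summable_LIMSEQ[OF summable_norm_cancel[OF elim]])
  qed
qed auto

lemma (in prob_space) law_block_sum:
  fixes V :: "nat \<Rightarrow> 'a \<Rightarrow> 'b::ordered_euclidean_space"
  assumes V_meas [measurable]: "\<And>j. V j \<in> borel_measurable M"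
    and V: "\<And>j. law M (V j) = nmul ((j + m) choose m) A"
    and ind: "indep_vars (\<lambda>_. borel) V {..<n}"
  shows "law M (\<lambda>\<omega>. \<Sum>j<n. (1 / b) ^ j *\<^sub>R V j \<omega>) = block_sum b m A n"
proof -
  have "indep_vars (\<lambda>_. borel) (\<lambda>j \<omega>. (1 / b) ^ j *\<^sub>R V j \<omega>) {..<n}"
    by (rule indep_vars_compose2[OF ind, of "\<lambda>j x. (1 / b) ^ j *\<^sub>R x"]) simp
  then have "law M (\<lambda>\<omega>. \<Sum>j<n. (1 / b) ^ j *\<^sub>R V j \<omega>) = (\<Sum>j<n. law M (\<lambda>\<omega>. (1 / b) ^ j *\<^sub>R V j \<omega>))"
    by (intro law_sum) simp
  then show ?thesis by (simp add: law_lscale V block_sum_def)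
qed

lemma log_moment_1_if_Suc: "log_moment (Suc k) A \<Longrightarrow> log_moment (Suc 0) A"
proof (induction k)
  case (Suc k)
  then show ?case using log_moment_Suc_imp[of "Suc k" A] by blast
qed

text \<open>The series of scaled i.i.d. variables converges almost surely once the order is 1; the
  full order \<open>Suc k\<close> is used only for the moment of its law.\<close>

lemma exists_fixpoint:
  fixes A :: "'a::ordered_euclidean_space law"
  assumes b: "1 < b" and A: "log_moment (Suc k) A"
  obtains \<rho> where "\<rho> = A + lscale (1 / b) \<rho>" "log_moment k \<rho>"
proof -
  define M where "M = PiM (UNIV :: nat set) (\<lambda>_. meas A)"
  define V where "V j \<omega> = \<omega> j" for j :: nat and \<omega> :: "nat \<Rightarrow> 'a"
  have V_eq: "(\<lambda>\<omega>. \<omega> j) = V j" for j by (simp add: V_def fun_eq_iff)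
  interpret prob_space M unfolding M_def by (rule exists_iid)
  have [measurable]: "V j \<in> borel_measurable M" for j
    unfolding M_def V_eq[symmetric] by (rule exists_iid)
  have law_V: "law M (V j) = A" for j
    unfolding M_def V_eq[symmetric] by (rule exists_iid)
  have "indep_vars (\<lambda>_. borel) V UNIV"
    unfolding M_def V_def[abs_def] by (rule exists_iid)
  then have ind: "indep_vars (\<lambda>_. borel) V {..<n}" for n
    by (rule indep_vars_subset) simp
  have A1: "log_moment (Suc 0) A"
    using A by (rule log_moment_1_if_Suc)
  have V0: "law M (V j) = nmul ((j + 0) choose 0) A" for j by (simp add: law_V)
  define Y where "Y \<omega> = (\<Sum>j. (1 / b) ^ j *\<^sub>R V j \<omega>)" for \<omega>
  have [measurable]: "Y \<in> borel_measurable M" unfolding Y_def[abs_def] by measurable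
  have sm: "AE \<omega> in M. summable (\<lambda>j. norm ((1 / b) ^ j *\<^sub>R V j \<omega>))"
    by (rule AE_summable_blocks[OF b _ V0 binomial_le_Suc_power A1]) simp
  have "law_tendsto (\<lambda>n. law M (\<lambda>\<omega>. \<Sum>j<n. (1 / b) ^ j *\<^sub>R V j \<omega>)) (law M Y)"
    unfolding Y_def[abs_def]
    by (rule law_tendsto_if_in_prob[OF _ _ blocks_converge[OF b _ V0 A1]]) auto
  then have "law_tendsto (block_sum b 0 A) (law M Y)"
    by (simp add: law_block_sum[OF _ V0 ind])
  moreover have "log_moment k (law M Y)"
    unfolding Y_def[abs_def] by (rule log_moment_law_suminf[OF b _ law_V A sm]) simp
  ultimately show ?thesis using that fixpoint_iff_block_sum_tendsto[OF b] by blast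
qed

lemma log_moment_fixpoint_iff:
  assumes \<rho>: "\<rho> = A + lscale (1 / b) \<rho>" and b: "1 < b"
  shows "log_moment k \<rho> \<longleftrightarrow> log_moment (Suc k) A"
proof
  assume "log_moment (Suc k) A"
  then obtain \<rho>' where \<rho>': "\<rho>' = A + lscale (1 / b) \<rho>'" and mom: "log_moment k \<rho>'"
    by (rule exists_fixpoint[OF b])
  \<comment> \<open>The moment was obtained for a constructed fixed point; uniqueness transfers it
    to the given one.\<close>
  from mom show "log_moment k \<rho>" unfolding fixpoint_unique[OF b \<rho>' \<rho>] .
qed (rule log_moment_Suc_if_fixpoint[OF \<rho> b])

text \<open>The counterpart of \<open>Phi\<close> on laws, independent of any choice of Levy
  processes; its value is unspecified where no unique fixed point exists.\<close>

definition phi_law :: "real \<Rightarrow> 'a::ordered_euclidean_space law \<Rightarrow> 'a law" where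
  "phi_law b A = (THE \<rho>. \<rho> = A + lscale (1 / b) \<rho>)"

lemma phi_law_eqI:
  assumes b: "1 < b" and \<rho>: "\<rho> = A + lscale (1 / b) \<rho>"
  shows "phi_law b A = \<rho>"
  unfolding phi_law_def
proof (rule the_equality)
  show "\<rho> = A + lscale (1 / b) \<rho>" by (rule \<rho>)
  show "\<rho>' = \<rho>" if "\<rho>' = A + lscale (1 / b) \<rho>'" for \<rho>'
    by (rule fixpoint_unique[OF b that \<rho>])
qed

lemma phi_law_fixpoint:
  assumes b: "1 < b" and A: "log_moment (Suc 0) A"
  shows "phi_law b A = A + lscale (1 / b) (phi_law b A)"
proof -
  obtain \<rho> where \<rho>: "\<rho> = A + lscale (1 / b) \<rho>" by (rule exists_fixpoint[OF b A])
  show ?thesis unfolding phi_law_eqI[OF b \<rho>] by (rule \<rho>)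
qed

text \<open>An exact identity. Replacing every pending copy of \<open>\<rho>\<close> at level
  \<open>n\<close> by \<open>A + lscale (1 / b) \<rho>\<close> releases a copy of \<open>A\<close>
  and passes a copy of \<open>\<rho>\<close> to level \<open>n + 1\<close>. The pending copies,
  \<open>n + m choose Suc m\<close> in number, and the new ones, \<open>n + m choose m\<close>, add
  up by Pascal's rule.\<close>

lemma block_sum_fixpoint:
  assumes \<rho>: "\<rho> = A + lscale (1 / b) \<rho>"
  shows "block_sum b m \<rho> n = block_sum b (Suc m) A n + lscale ((1 / b) ^ n) (nmul ((n + m) choose Suc m) \<rho>)"
proof (induction n)
  case 0
  show ?case by (simp add: block_sum_def binomial_eq_0)
next
  case (Suc n)
  define K where "K = (n + Suc m) choose Suc m"
  have K: "(n + m choose Suc m) + (n + m choose m) = K"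
    by (simp add: K_def)
  have "block_sum b m \<rho> (Suc n) = block_sum b (Suc m) A n +
      lscale ((1 / b) ^ n) (nmul ((n + m) choose Suc m) \<rho> + nmul ((n + m) choose m) \<rho>)"
    using Suc by (simp add: block_sum_def lscale_plus add.assoc)
  also have "nmul ((n + m) choose Suc m) \<rho> + nmul ((n + m) choose m) \<rho> = nmul K \<rho>"
    unfolding K[symmetric] nmul_add ..
  also have "nmul K \<rho> = nmul K A + lscale (1 / b) (nmul K \<rho>)"
    by (rule fixpoint_nmul[OF \<rho>])
  finally show ?case
    by (simp add: block_sum_def K_def lscale_plus lscale_lscale add.assoc mult.commute)
qed

text \<open>The innermost application of \<open>phi_law\<close> is peeled off, hence the arbitrary
  \<open>A\<close>. The pending copies of \<open>\<rho>\<close> grow with degree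
  \<open>Suc m\<close>, and \<open>Suc m\<close> is the order of moment that \<open>\<rho>\<close>
  retains, so the perturbation vanishes.\<close>

lemma block_sum_tendsto_phi_law:
  assumes b: "1 < b"
  shows "log_moment (Suc m) A \<Longrightarrow> law_tendsto (block_sum b m A) ((phi_law b ^^ Suc m) A)"
proof (induction m arbitrary: A)
  case 0
  then show ?case
    using phi_law_fixpoint[OF b, of A] unfolding fixpoint_iff_block_sum_tendsto[OF b] by simp
next
  case (Suc m)
  define \<rho> where "\<rho> = phi_law b A"
  have \<rho>: "\<rho> = A + lscale (1 / b) \<rho>"
    unfolding \<rho>_def using Suc.prems by (intro phi_law_fixpoint[OF b] log_moment_1_if_Suc)
  have mom: "log_moment (Suc m) \<rho>" using Suc.prems log_moment_fixpoint_iff[OF \<rho> b] by blast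
  have "law_tendsto (block_sum b m \<rho>) ((phi_law b ^^ Suc m) \<rho>) \<longleftrightarrow>
      law_tendsto (block_sum b (Suc m) A) ((phi_law b ^^ Suc m) \<rho>)"
  proof (rule law_tendsto_perturb_iff[OF block_sum_fixpoint[OF \<rho>]])
    have N: "(n + m) choose Suc m \<le> Suc n ^ Suc m" for n
      using binomial_le_Suc_power[of n "Suc m"] by simp
    show "(\<lambda>n. tail (lscale ((1 / b) ^ n) (nmul ((n + m) choose Suc m) \<rho>)) e) \<longlonglongrightarrow> 0"
      if "0 < e" for e
      by (rule tail_lscale_nmul_tendsto_0[OF mom b that N])
  qed
  moreover have "law_tendsto (block_sum b m \<rho>) ((phi_law b ^^ Suc m) \<rho>)"
    by (rule Suc.IH[OF mom])
  ultimately show ?case by (simp add: \<rho>_def funpow_swap1)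
qed

section \<open>Infinite divisibility in the monoid\<close>

definition inf_div_law :: "'a::ordered_euclidean_space law \<Rightarrow> bool" where
  "inf_div_law A \<longleftrightarrow> (\<forall>n\<ge>1. \<exists>B. A = nmul n B)"

lemma meas_nmul: "conv_power n (meas B) = meas (nmul n B)"
  by (induction n) (simp_all add: conv_power_def meas_zero meas_plus)

lemma is_distribution_meas: "is_distribution (meas A)"
  by (simp add: is_distribution_def)

lemma is_distribution_Law: "is_distribution \<mu> \<Longrightarrow> meas (Law \<mu>) = \<mu>"
  by (simp add: is_distribution_def meas_Law)

lemma meas_in_inf_div_iff: "meas A \<in> inf_div \<longleftrightarrow> inf_div_law A"
proof -
  have "(\<exists>\<nu>. is_distribution \<nu> \<and> meas A = conv_power n \<nu>) \<longleftrightarrow> (\<exists>B. A = nmul n B)" for n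
  proof
    assume "\<exists>\<nu>. is_distribution \<nu> \<and> meas A = conv_power n \<nu>"
    then obtain \<nu> where "is_distribution \<nu>" "meas A = conv_power n \<nu>" by blast
    then have "meas A = meas (nmul n (Law \<nu>))"
      using meas_nmul[of n "Law \<nu>"] by (simp add: is_distribution_Law)
    then show "\<exists>B. A = nmul n B" by (auto simp: meas_inject)
  next
    assume "\<exists>B. A = nmul n B"
    then obtain B where "A = nmul n B" ..
    then show "\<exists>\<nu>. is_distribution \<nu> \<and> meas A = conv_power n \<nu>"
      by (intro exI[of _ "meas B"]) (simp add: is_distribution_meas meas_nmul)
  qed
  then show ?thesis by (simp add: inf_div_def inf_div_law_def is_distribution_meas)
qed

lemma meas_in_inf_div_log_iff: "meas A \<in> inf_div_log k \<longleftrightarrow> inf_div_law A \<and> log_moment k A"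
  by (simp add: inf_div_log_def meas_in_inf_div_iff log_moment_def logp_def)

text \<open>A convolution root \<open>B\<close> of \<open>A\<close> inherits the logarithmic moment
  and so has a fixed point; its multiple solves the equation for \<open>A\<close> and is the fixed
  point of \<open>A\<close> by uniqueness.\<close>

lemma inf_div_law_phi_law:
  assumes b: "1 < b" and A: "log_moment (Suc 0) A" "inf_div_law A"
  shows "inf_div_law (phi_law b A)"
  unfolding inf_div_law_def
proof (intro allI impI)
  fix n :: nat assume n: "1 \<le> n"
  obtain B where B: "A = nmul n B" using A(2) n by (auto simp: inf_div_law_def)
  have "log_moment (Suc 0) B" using A(1) n unfolding B by (auto intro: log_moment_nmulD)
  then have "nmul n (phi_law b B) = A + lscale (1 / b) (nmul n (phi_law b B))"
    unfolding B by (intro fixpoint_nmul[OF phi_law_fixpoint[OF b]])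
  then have "phi_law b A = nmul n (phi_law b B)" by (rule phi_law_eqI[OF b])
  then show "\<exists>B. phi_law b A = nmul n B" by blast
qed

section \<open>Integrals of step functions with respect to a Levy process\<close>

text \<open>Only the open blocks are constrained, in accordance with \<open>step_partition\<close>.
  The clause \<open>a_neq\<close> makes the block ends visible to the partition that
  \<open>step_integral\<close> selects by choice.\<close>

locale step_blocks =
  fixes f :: "real \<Rightarrow> real" and c a :: "nat \<Rightarrow> real"
  assumes c_0: "c 0 = 0" and c_less: "c j < c (Suc j)" and c_unbounded: "\<exists>n. t < c n"
    and f_block: "c j < s \<Longrightarrow> s < c (Suc j) \<Longrightarrow> f s = a j" and a_neq: "a j \<noteq> a (Suc j)"
begin

lemma c_mono: "i \<le> j \<Longrightarrow> c i \<le> c j"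
  by (rule lift_Suc_mono_le[of c]) (use c_less in \<open>auto intro: less_imp_le\<close>)

lemma c_less_iff: "c i < c j \<longleftrightarrow> i < j"
  using lift_Suc_mono_less_iff[of c, OF c_less] .

lemma c_nonneg: "0 \<le> c j"
  using c_mono[of 0 j] c_0 by simp

lemma block_exists:
  assumes "0 \<le> t"
  obtains j where "c j \<le> t" "t < c (Suc j)"
proof -
  define n where "n = (LEAST n. t < c n)"
  have n: "t < c n" unfolding n_def using c_unbounded by (rule LeastI_ex)
  then have "n \<noteq> 0" using assms c_0 by (intro notI) simp
  then obtain j where j: "n = Suc j" by (cases n) auto
  have "\<not> t < c j" using not_less_Least[of j "\<lambda>n. t < c n"] j unfolding n_def[symmetric] by simp
  then show ?thesis using that n j by (simp add: not_less)
qed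

text \<open>As \<open>f\<close> takes different values on both sides of \<open>c (Suc j)\<close>, every partition contains these points.\<close>

lemma partition_in_block:
  assumes \<tau>: "step_partition f t n \<tau>" and i: "i < n" and nonneg: "0 \<le> \<tau> i"
  obtains j where "c j \<le> \<tau> i" "\<tau> (Suc i) \<le> c (Suc j)"
proof -
  obtain j where j: "c j \<le> \<tau> i" "\<tau> i < c (Suc j)" using block_exists[OF nonneg] .
  have "\<tau> (Suc i) \<le> c (Suc j)"
  proof (rule ccontr)
    assume "\<not> ?thesis"
    then have less: "c (Suc j) < \<tau> (Suc i)" by simp
    obtain s where s: "\<tau> i < s" "s < c (Suc j)" using dense[OF j(2)] by blast
    obtain s' where s': "c (Suc j) < s'" "s' < min (\<tau> (Suc i)) (c (Suc (Suc j)))"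
      using dense[of "c (Suc j)" "min (\<tau> (Suc i)) (c (Suc (Suc j)))"] less c_less by auto
    have "f constant_on {\<tau> i<..<\<tau> (Suc i)}" using \<tau> i by (simp add: step_partition_def)
    then have "f s = f s'" using s s' less by (auto simp: constant_on_def)
    moreover have "f s = a j" using s j by (intro f_block) auto
    moreover have "f s' = a (Suc j)" using s' by (intro f_block) auto
    ultimately show False using a_neq[of j] by simp
  qed
  then show ?thesis using that j by blast
qed

text \<open>The integral written over the fixed blocks, each cut off at \<open>t\<close>. No
  partition occurs in it, and blocks beyond \<open>t\<close> contribute 0, so \<open>N\<close> only
  has to be large enough.\<close>

definition clipped_integral :: "(real \<Rightarrow> 'v::real_vector) \<Rightarrow> nat \<Rightarrow> real \<Rightarrow> 'v" where
  "clipped_integral x N t = (\<Sum>j<N. a j *\<^sub>R (x (min t (c (Suc j))) - x (min t (c j))))"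

lemma clipped_integral_diff:
  assumes "c j \<le> s" "s \<le> s'" "s' \<le> c (Suc j)" "j < N"
  shows "clipped_integral x N s' - clipped_integral x N s = a j *\<^sub>R (x s' - x s)"
proof -
  have "clipped_integral x N s' - clipped_integral x N s =
      (\<Sum>k<N. if k = j then a j *\<^sub>R (x s' - x s) else 0)"
    unfolding clipped_integral_def sum_subtractf[symmetric]
  proof (rule sum.cong[OF refl])
    fix k
    consider "k < j" | "k = j" | "j < k" by linarith
    then show "a k *\<^sub>R (x (min s' (c (Suc k))) - x (min s' (c k))) - a k *\<^sub>R (x (min s (c (Suc k))) - x (min s (c k)))
        = (if k = j then a j *\<^sub>R (x s' - x s) else 0)"
    proof cases
      case 1
      then have "c k \<le> c j" "c (Suc k) \<le> c j" by (auto intro!: c_mono)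
      then have "min s' (c (Suc k)) = c (Suc k)" "min s' (c k) = c k" "min s (c (Suc k)) = c (Suc k)" "min s (c k) = c k"
        using assms by (auto simp: min_def)
      then show ?thesis using 1 by simp
    next
      case 2
      then show ?thesis using assms by (auto simp: min_def algebra_simps)
    next
      case 3
      then have "c (Suc j) \<le> c k" "c (Suc j) \<le> c (Suc k)" by (auto intro!: c_mono)
      then have "min s' (c (Suc k)) = s'" "min s' (c k) = s'" "min s (c (Suc k)) = s" "min s (c k) = s"
        using assms by (auto simp: min_def)
      then show ?thesis using 3 by simp
    qed
  qed
  also have "\<dots> = a j *\<^sub>R (x s' - x s)" using assms(4) by simp
  finally show ?thesis .
qed

text \<open>Every cell lies in a single block, so its term is an increment of
  \<open>clipped_integral\<close> and the sum telescopes. This makes the choice of the partition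
  irrelevant.\<close>

lemma partition_sum_eq:
  assumes \<tau>: "step_partition f t n \<tau>" and N: "t \<le> c N"
  shows "(\<Sum>i<n. f ((\<tau> i + \<tau> (Suc i)) / 2) *\<^sub>R (x (\<tau> (Suc i)) - x (\<tau> i))) = clipped_integral x N t"
proof -
  have \<tau>0: "\<tau> 0 = 0" and \<tau>n: "\<tau> n = t" and less: "\<And>i. i < n \<Longrightarrow> \<tau> i < \<tau> (Suc i)"
    using \<tau> by (auto simp: step_partition_def)
  have mono: "\<tau> i \<le> \<tau> k" if "i \<le> k" "k \<le> n" for i k
    using that
  proof (induction k)
    case (Suc k)
    then show ?case using less[of k] by (cases "i = Suc k") (auto intro: order_trans)
  qed simp
  have "f ((\<tau> i + \<tau> (Suc i)) / 2) *\<^sub>R (x (\<tau> (Suc i)) - x (\<tau> i)) =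
      clipped_integral x N (\<tau> (Suc i)) - clipped_integral x N (\<tau> i)" if i: "i < n" for i
  proof -
    have "0 \<le> \<tau> i" using mono[of 0 i] \<tau>0 i by simp
    then obtain j where j: "c j \<le> \<tau> i" "\<tau> (Suc i) \<le> c (Suc j)"
      using partition_in_block[OF \<tau> i] by blast
    have "c j < c N" using j less[OF i] mono[of "Suc i" n] \<tau>n N i by simp
    then have "j < N" by (simp add: c_less_iff)
    moreover have "f ((\<tau> i + \<tau> (Suc i)) / 2) = a j"
      using j less[OF i] by (intro f_block) auto
    ultimately show ?thesis
      using clipped_integral_diff[of j "\<tau> i" "\<tau> (Suc i)" N x] j less[OF i] by simp
  qed
  then have "(\<Sum>i<n. f ((\<tau> i + \<tau> (Suc i)) / 2) *\<^sub>R (x (\<tau> (Suc i)) - x (\<tau> i))) =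
      (\<Sum>i<n. clipped_integral x N (\<tau> (Suc i)) - clipped_integral x N (\<tau> i))"
    by (intro sum.cong) auto
  also have "\<dots> = clipped_integral x N t - clipped_integral x N 0"
    using sum_lessThan_telescope[of "\<lambda>i. clipped_integral x N (\<tau> i)" n] by (simp only: \<tau>0 \<tau>n)
  also have "clipped_integral x N 0 = 0"
    using c_nonneg by (simp add: clipped_integral_def min_def)
  finally show ?thesis by simp
qed

lemma partition_exists:
  assumes t: "0 \<le> t"
  shows "\<exists>n \<tau>. step_partition f t n \<tau>"
proof (cases "t = 0")
  case True
  then show ?thesis by (intro exI[of _ 0] exI[of _ "\<lambda>_. 0"]) (simp add: step_partition_def)
next
  case False
  define n where "n = (LEAST n. t \<le> c n)"
  have ex: "\<exists>n. t \<le> c n" using c_unbounded[of t] less_imp_le by blast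
  have n: "t \<le> c n" unfolding n_def using ex by (rule LeastI_ex)
  have lt: "c i < t" if "i < n" for i
    using not_less_Least[of i "\<lambda>n. t \<le> c n"] that unfolding n_def[symmetric] by simp
  have "n \<noteq> 0" using n False t c_0 by (intro notI) simp
  \<comment> \<open>All block ends before \<open>t\<close>, followed by \<open>t\<close>; as
    \<open>n\<close> is least with \<open>t \<le> c n\<close>, only the last cell can be an
    incomplete block.\<close>
  define \<tau> where "\<tau> i = (if i = n then t else c i)" for i
  have "step_partition f t n \<tau>"
    unfolding step_partition_def
  proof (intro conjI allI impI)
    fix i assume i: "i < n"
    show "\<tau> i < \<tau> (Suc i)" using i lt[OF i] c_less[of i] by (auto simp: \<tau>_def)
    have "\<tau> i = c i" "\<tau> (Suc i) \<le> c (Suc i)" using i n by (auto simp: \<tau>_def)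
    then show "f constant_on {\<tau> i<..<\<tau> (Suc i)}"
      unfolding constant_on_def by (intro exI[of _ "a i"]) (auto intro!: f_block)
  qed (use \<open>n \<noteq> 0\<close> c_0 in \<open>auto simp: \<tau>_def\<close>)
  then show ?thesis by blast
qed

lemma step_function: "step_function f"
  using partition_exists by (simp add: step_function_def)

lemma step_integral_eq_clipped:
  assumes "0 \<le> t" "t \<le> c N"
  shows "step_integral X f t \<omega> = clipped_integral (\<lambda>s. X s \<omega>) N t"
proof -
  define p where "p = (SOME (n, \<tau>). step_partition f t n \<tau>)"
  have "\<exists>p. case p of (n, \<tau>) \<Rightarrow> step_partition f t n \<tau>"
    using partition_exists[OF assms(1)] by auto
  then have "case p of (n, \<tau>) \<Rightarrow> step_partition f t n \<tau>"
    unfolding p_def by (rule someI_ex)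
  then show ?thesis
    using partition_sum_eq[OF _ assms(2), of _ _ "\<lambda>s. X s \<omega>"]
    unfolding step_integral_def p_def[symmetric] by (auto split: prod.splits)
qed

lemma step_integral_eq:
  assumes "c n \<le> t" "t \<le> c (Suc n)"
  shows "step_integral X f t \<omega> = (\<Sum>j<n. a j *\<^sub>R (X (c (Suc j)) \<omega> - X (c j) \<omega>)) + a n *\<^sub>R (X t \<omega> - X (c n) \<omega>)"
proof -
  have "0 \<le> t" using assms c_nonneg[of n] by simp
  then have "step_integral X f t \<omega> = clipped_integral (\<lambda>s. X s \<omega>) (Suc n) t"
    using assms(2) by (rule step_integral_eq_clipped)
  also have "\<dots> = (\<Sum>j<n. a j *\<^sub>R (X (min t (c (Suc j))) \<omega> - X (min t (c j)) \<omega>)) + a n *\<^sub>R (X t \<omega> - X (c n) \<omega>)"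
    using assms by (simp add: clipped_integral_def min_absorb1 min_absorb2)
  also have "(\<Sum>j<n. a j *\<^sub>R (X (min t (c (Suc j))) \<omega> - X (min t (c j)) \<omega>)) = (\<Sum>j<n. a j *\<^sub>R (X (c (Suc j)) \<omega> - X (c j) \<omega>))"
  proof (rule sum.cong[OF refl])
    fix j assume "j \<in> {..<n}"
    then have "c j \<le> c n" "c (Suc j) \<le> c n" by (auto intro!: c_mono)
    then show "a j *\<^sub>R (X (min t (c (Suc j))) \<omega> - X (min t (c j)) \<omega>) = a j *\<^sub>R (X (c (Suc j)) \<omega> - X (c j) \<omega>)"
      using assms by (simp add: min_absorb2)
  qed
  finally show ?thesis .
qed

lemma step_integral_c:
  "step_integral X f (c n) \<omega> = (\<Sum>j<n. a j *\<^sub>R (X (c (Suc j)) \<omega> - X (c j) \<omega>))"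
  using step_integral_eq[of n "c n" X \<omega>] c_less[of n] by simp

lemma filterlim_c: "filterlim c at_top sequentially"
  unfolding filterlim_at_top
proof
  fix Z
  obtain n where "Z < c n" using c_unbounded by blast
  then have "Z \<le> c k" if "n \<le> k" for k using c_mono[OF that] by simp
  then show "\<forall>\<^sub>F n in sequentially. Z \<le> c n" by (auto simp: eventually_sequentially)
qed

end

section \<open>Laws of the increments\<close>

context levy_process
begin

text \<open>The difference to \<open>X 0\<close> is kept because \<open>X 0\<close> vanishes only
  almost surely; this is also the form in which \<open>stationary_increments\<close> is
  stated.\<close>

definition inc_law :: "real \<Rightarrow> (real ^ 'd) law" where
  "inc_law t = law M (\<lambda>\<omega>. X t \<omega> - X 0 \<omega>)"

lemma measurable_inc: "0 \<le> s \<Longrightarrow> 0 \<le> t \<Longrightarrow> (\<lambda>\<omega>. X t \<omega> - X s \<omega>) \<in> borel_measurable M"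
  using measurable_X by (intro borel_measurable_diff) auto

lemma law_increment: "0 \<le> s \<Longrightarrow> s \<le> t \<Longrightarrow> law M (\<lambda>\<omega>. X t \<omega> - X s \<omega>) = inc_law (t - s)"
  using stationary_increments[of s "t - s"] by (simp add: law_def inc_law_def)

lemma indep_blocks:
  "0 \<le> \<tau> 0 \<Longrightarrow> (\<And>i. \<tau> i < \<tau> (Suc i)) \<Longrightarrow>
    indep_vars (\<lambda>_. borel) (\<lambda>i \<omega>. X (\<tau> (Suc i)) \<omega> - X (\<tau> i) \<omega>) {..<n::nat}"
  by (rule indep_increments)

lemma inc_law_0: "inc_law 0 = 0"
  unfolding inc_law_def
  by (rule law_eqI) (simp add: nn_integral_law nn_integral_zero_law emeasure_space_1)

lemma inc_law_add:
  assumes "0 \<le> s" "0 \<le> t"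
  shows "inc_law (s + t) = inc_law s + inc_law t"
proof (cases "s = 0 \<or> t = 0")
  case False
  then have st: "0 < s" "0 < t" using assms by auto
  \<comment> \<open>Only the times 0, \<open>s\<close> and \<open>s + t\<close> matter; the later
    values continue the sequence because \<open>indep_blocks\<close> asks for strict increase at
    every index.\<close>
  define \<tau> where "\<tau> i = (if i = 0 then 0 else if i = Suc 0 then s else s + t + real i - 2)" for i
  have "indep_vars (\<lambda>_. borel) (\<lambda>i \<omega>. X (\<tau> (Suc i)) \<omega> - X (\<tau> i) \<omega>) {..<2}"
    using st by (intro indep_blocks) (auto simp: \<tau>_def)
  then have "law M (\<lambda>\<omega>. \<Sum>i<2. X (\<tau> (Suc i)) \<omega> - X (\<tau> i) \<omega>) = (\<Sum>i<2. law M (\<lambda>\<omega>. X (\<tau> (Suc i)) \<omega> - X (\<tau> i) \<omega>))"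
    by (intro law_sum) auto
  then have "law M (\<lambda>\<omega>. X (s + t) \<omega> - X 0 \<omega>) = law M (\<lambda>\<omega>. X s \<omega> - X 0 \<omega>) + law M (\<lambda>\<omega>. X (s + t) \<omega> - X s \<omega>)"
    by (simp add: \<tau>_def numeral_2_eq_2)
  then show ?thesis using law_increment[of s "s + t"] st by (simp add: inc_law_def)
qed (auto simp: inc_law_0)

lemma inc_law_of_nat: "inc_law (real n) = nmul n (inc_law 1)"
proof (induction n)
  case (Suc n)
  have "inc_law (real (Suc n)) = inc_law (1 + real n)" by (simp add: add.commute)
  also have "\<dots> = inc_law 1 + inc_law (real n)" by (rule inc_law_add) auto
  finally show ?case using Suc by simp
qed (simp add: inc_law_0)

lemma meas_inc_law_1: "meas (inc_law 1) = distr M borel (X 1)"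
proof -
  have "distr M borel (\<lambda>\<omega>. X 1 \<omega> - X 0 \<omega>) = distr M borel (X 1)"
    using start_zero measurable_inc[of 0 1] measurable_X[of 1] by (intro distr_cong_AE) auto
  then show ?thesis using measurable_inc[of 0 1] by (simp add: inc_law_def meas_law)
qed

lemma tail_inc_law: "0 \<le> t \<Longrightarrow> tail (inc_law t) e = prob {\<omega> \<in> space M. e < dist (X t \<omega>) (X 0 \<omega>)}"
  using measurable_inc[of 0 t] by (simp add: inc_law_def tail_law dist_norm)

text \<open>Otherwise some times in the unit interval would keep mass \<open>\<eta>\<close> beyond
  every integer. A subsequence of them converges to \<open>l\<close>, and stochastic continuity at
  \<open>l\<close> forces this mass onto the single law \<open>inc_law l\<close>, whose tail
  vanishes.\<close>

lemma inc_law_uniformly_tight: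
  assumes \<eta>: "0 < \<eta>"
  shows "\<exists>K. \<forall>s\<in>{0..1}. tail (inc_law s) K < \<eta>"
proof (rule ccontr)
  assume "\<not> ?thesis"
  then have "\<forall>n. \<exists>s\<in>{0..1}. \<eta> \<le> tail (inc_law s) (real n)" by (force simp: not_less)
  then obtain s where s: "\<And>n. s n \<in> {0..1}" "\<And>n. \<eta> \<le> tail (inc_law (s n)) (real n)" by metis
  obtain l r where l: "l \<in> {0..1}" and r: "strict_mono (r :: nat \<Rightarrow> nat)" and lim: "(s \<circ> r) \<longlonglongrightarrow> l"
    using compact_imp_seq_compact[of "{0..1 :: real}"] s(1) unfolding seq_compact_def by (metis compact_Icc)
  have "((\<lambda>s. prob {\<omega> \<in> space M. dist (X s \<omega>) (X l \<omega>) > 1}) \<longlongrightarrow> 0) (at l within {0..})"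
    using l by (intro stoch_continuous) auto
  \<comment> \<open>The filter \<open>at l within {0..}\<close> omits \<open>l\<close> itself; the
    value 0 there turns the limit into continuity, so the subsequence may hit
    \<open>l\<close>.\<close>
  moreover have "prob {\<omega> \<in> space M. dist (X l \<omega>) (X l \<omega>) > 1} = 0" by simp
  ultimately have "continuous (at l within {0..}) (\<lambda>s. prob {\<omega> \<in> space M. dist (X s \<omega>) (X l \<omega>) > 1})"
    by (simp add: continuous_within)
  then have 1: "(\<lambda>n. prob {\<omega> \<in> space M. dist (X (s (r n)) \<omega>) (X l \<omega>) > 1}) \<longlonglongrightarrow> 0"
    using lim s(1) continuous_within_tendsto_compose[of l "{0..}" _ "\<lambda>n. s (r n)" sequentially]
    by (fastforce simp: o_def)
  have "filterlim (\<lambda>n. real (r n) - 1) at_top sequentially"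
    using filterlim_compose[OF filterlim_real_sequentially filterlim_subseq[OF r]]
    by (intro filterlim_tendsto_add_at_top[of "\<lambda>_. -1", simplified]) auto
  then have 2: "(\<lambda>n. tail (inc_law l) (real (r n) - 1)) \<longlonglongrightarrow> 0"
    by (rule tail_filterlim)
  have "\<eta> \<le> prob {\<omega> \<in> space M. dist (X (s (r n)) \<omega>) (X l \<omega>) > 1} + tail (inc_law l) (real (r n) - 1)" for n
  proof -
    have nonneg: "0 \<le> s (r n)" "0 \<le> l" using s(1)[of "r n"] l by auto
    note [measurable] = measurable_X[OF nonneg(1)] measurable_X[OF nonneg(2)] measurable_X[OF order_refl]
    have "\<eta> \<le> prob {\<omega> \<in> space M. real (r n) < dist (X (s (r n)) \<omega>) (X 0 \<omega>)}"
      using s(2)[of "r n"] nonneg by (simp add: tail_inc_law)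
    also have "\<dots> \<le> prob ({\<omega> \<in> space M. dist (X (s (r n)) \<omega>) (X l \<omega>) > 1} \<union> {\<omega> \<in> space M. real (r n) - 1 < dist (X l \<omega>) (X 0 \<omega>)})"
    proof (rule finite_measure_mono)
      show "{\<omega> \<in> space M. real (r n) < dist (X (s (r n)) \<omega>) (X 0 \<omega>)} \<subseteq>
        {\<omega> \<in> space M. dist (X (s (r n)) \<omega>) (X l \<omega>) > 1} \<union> {\<omega> \<in> space M. real (r n) - 1 < dist (X l \<omega>) (X 0 \<omega>)}"
      proof
        fix \<omega> assume "\<omega> \<in> {\<omega> \<in> space M. real (r n) < dist (X (s (r n)) \<omega>) (X 0 \<omega>)}"
        then show "\<omega> \<in> {\<omega> \<in> space M. dist (X (s (r n)) \<omega>) (X l \<omega>) > 1} \<union> {\<omega> \<in> space M. real (r n) - 1 < dist (X l \<omega>) (X 0 \<omega>)}"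
          using dist_triangle[of "X (s (r n)) \<omega>" "X 0 \<omega>" "X l \<omega>"] by auto
      qed
    qed measurable
    also have "\<dots> \<le> prob {\<omega> \<in> space M. dist (X (s (r n)) \<omega>) (X l \<omega>) > 1} + prob {\<omega> \<in> space M. real (r n) - 1 < dist (X l \<omega>) (X 0 \<omega>)}"
      by (rule measure_Un_le) measurable
    finally show ?thesis using nonneg by (simp add: tail_inc_law)
  qed
  then have "\<eta> \<le> 0 + 0"
    by (intro LIMSEQ_le_const[OF tendsto_add[OF 1 2]]) auto
  then show False using \<eta> by simp
qed

end

section \<open>The time change\<close>

text \<open>The value of \<open>f_m m\<close> at the integer \<open>j\<close>: by the hockey-stick
  identity it is the sum of \<open>i + m choose m\<close> over \<open>i < j\<close>.\<close>

definition block_time :: "nat \<Rightarrow> nat \<Rightarrow> real" where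
  "block_time m j = real ((j + m) choose Suc m)"

lemma block_time_0: "block_time m 0 = 0"
  by (simp add: block_time_def binomial_eq_0)

lemma block_time_Suc: "block_time m (Suc j) = block_time m j + real ((j + m) choose m)"
  by (simp add: block_time_def)

lemma block_time_less: "block_time m j < block_time m (Suc j)"
  by (simp add: block_time_Suc)

lemma block_time_ge: "real j \<le> block_time m j"
proof (induction j)
  case (Suc j)
  have "1 \<le> (j + m) choose m" by (simp add: Suc_le_eq)
  then have "1 \<le> real ((j + m) choose m)" by linarith
  with Suc show ?case by (simp add: block_time_Suc)
qed (simp add: block_time_0)

lemma block_time_mono: "i \<le> j \<Longrightarrow> block_time m i \<le> block_time m j"
  by (rule lift_Suc_mono_le[of "block_time m"]) (use block_time_less in \<open>auto intro: less_imp_le\<close>)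

text \<open>The case \<open>x = 1\<close> is included so that the induction can join intervals at
  integers; the floor then jumps at the right end point only, which is a spike at a single
  point.\<close>

lemma f_m_has_integral:
  assumes "0 \<le> x" "x \<le> 1"
  shows "((\<lambda>v. real ((nat \<lfloor>v\<rfloor> + m) choose m)) has_integral
    (block_time m j + real ((j + m) choose m) * x)) {0..real j + x}"
  using assms
proof (induction j arbitrary: x)
  case 0
  have "((\<lambda>v. real ((nat \<lfloor>v\<rfloor> + m) choose m)) has_integral (real (m choose m) * x)) {0..x}"
  proof (rule has_integral_spike_finite[of "{1}"])
    show "((\<lambda>v. real (m choose m)) has_integral real (m choose m) * x) {0..x}"
      using has_integral_const_real[of "real (m choose m)" 0 x] 0 by simp
    fix v assume "v \<in> {0..x} - {1}"
    then have "\<lfloor>v\<rfloor> = 0" using 0 by (auto simp: floor_eq_iff)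
    then show "real ((nat \<lfloor>v\<rfloor> + m) choose m) = real (m choose m)" by simp
  qed simp
  then show ?case by (simp add: block_time_0)
next
  case (Suc j)
  have "((\<lambda>v. real ((nat \<lfloor>v\<rfloor> + m) choose m)) has_integral (real ((Suc j + m) choose m) * x)) {real j + 1..real (Suc j) + x}"
  proof (rule has_integral_spike_finite[of "{real (Suc j) + 1}"])
    show "((\<lambda>v. real ((Suc j + m) choose m)) has_integral real ((Suc j + m) choose m) * x) {real j + 1..real (Suc j) + x}"
      using has_integral_const_real[of "real ((Suc j + m) choose m)" "real j + 1" "real (Suc j) + x"] Suc.prems
      by (simp add: mult.commute)
    fix v assume "v \<in> {real j + 1..real (Suc j) + x} - {real (Suc j) + 1}"
    then have "\<lfloor>v\<rfloor> = int (Suc j)" using Suc.prems by (auto simp: floor_eq_iff)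
    then have "nat \<lfloor>v\<rfloor> = Suc j" by (simp only: nat_int)
    then show "real ((nat \<lfloor>v\<rfloor> + m) choose m) = real ((Suc j + m) choose m)" by simp
  qed simp
  moreover have "((\<lambda>v. real ((nat \<lfloor>v\<rfloor> + m) choose m)) has_integral
    (block_time m j + real ((j + m) choose m) * 1)) {0..real j + 1}"
    by (rule Suc.IH) auto
  ultimately have "((\<lambda>v. real ((nat \<lfloor>v\<rfloor> + m) choose m)) has_integral
    (block_time m j + real ((j + m) choose m) * 1 + real ((Suc j + m) choose m) * x)) {0..real (Suc j) + x}"
    using Suc.prems by (intro has_integral_combine[of 0 "real j + 1" "real (Suc j) + x"]) auto
  then show ?case by (simp add: block_time_Suc)
qed

lemma f_m_eq:
  "0 \<le> x \<Longrightarrow> x \<le> 1 \<Longrightarrow> f_m m (real j + x) = block_time m j + real ((j + m) choose m) * x"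
  unfolding f_m_def by (rule integral_unique[OF f_m_has_integral])

lemma nonneg_real_split:
  fixes u :: real
  assumes "0 \<le> u"
  obtains j x where "u = real j + x" "0 \<le> x" "x < 1"
proof (rule that[of "nat \<lfloor>u\<rfloor>" "u - real (nat \<lfloor>u\<rfloor>)"])
  show "0 \<le> u - real (nat \<lfloor>u\<rfloor>)" "u - real (nat \<lfloor>u\<rfloor>) < 1"
    using assms by linarith+
qed simp

lemma f_m_strict_mono:
  assumes "0 \<le> u" "u < v"
  shows "f_m m u < f_m m v"
proof -
  have "0 \<le> v" using assms by simp
  obtain j x where u: "u = real j + x" "0 \<le> x" "x < 1" by (rule nonneg_real_split[OF assms(1)])
  obtain k y where v: "v = real k + y" "0 \<le> y" "y < 1" by (rule nonneg_real_split[OF \<open>0 \<le> v\<close>])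
  have fu: "f_m m u = block_time m j + real ((j + m) choose m) * x"
    and fv: "f_m m v = block_time m k + real ((k + m) choose m) * y"
    using u v by (simp_all add: f_m_eq)
  have C: "0 < real ((j + m) choose m)" by simp
  consider "j < k" | "j = k" "x < y" using assms(2) u v by linarith
  then show ?thesis
  proof cases
    case 1
    have "real ((j + m) choose m) * x < real ((j + m) choose m) * 1"
      using C u by (intro mult_strict_left_mono)
    then have "f_m m u < block_time m (Suc j)" by (simp add: fu block_time_Suc)
    also have "\<dots> \<le> block_time m k" using 1 by (intro block_time_mono) simp
    also have "\<dots> \<le> f_m m v" unfolding fv using v(2) by simp
    finally show ?thesis .
  next
    case 2
    then have "real ((j + m) choose m) * x < real ((j + m) choose m) * y"
      using C by (intro mult_strict_left_mono)
    then show ?thesis using 2(1) unfolding fu fv by simp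
  qed
qed

lemma inj_on_f_m: "inj_on (f_m m) {0..}"
proof (rule linorder_inj_onI')
  fix u v :: real assume "u \<in> {0..}" "u < v"
  then show "f_m m u \<noteq> f_m m v" using f_m_strict_mono[of u v m] by simp
qed

text \<open>On each block \<open>f_m m\<close> is affine, so the preimage of \<open>s\<close> can be
  written down as \<open>real j + x\<close> with \<open>x\<close> in the half-open unit
  interval.\<close>

lemma floor_f_m_inv:
  assumes "block_time m j \<le> s" "s < block_time m (Suc j)"
  shows "\<lfloor>f_m_inv m s\<rfloor> = int j"
proof -
  define x where "x = (s - block_time m j) / real ((j + m) choose m)"
  have C: "0 < real ((j + m) choose m)" by simp
  have x: "0 \<le> x" "x < 1"
    using assms C by (simp_all add: x_def block_time_Suc divide_less_eq)
  have "f_m m (real j + x) = s"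
    using x C by (simp add: f_m_eq) (simp add: x_def)
  then have "f_m_inv m s = real j + x"
    unfolding f_m_inv_def using x by (intro the_inv_into_f_eq[OF inj_on_f_m]) auto
  then show ?thesis using x by (simp add: floor_eq_iff)
qed

lemma powi_neg_floor: "\<lfloor>t\<rfloor> = int j \<Longrightarrow> b powi (- \<lfloor>t\<rfloor>) = (1 / b :: real) ^ j"
  by (simp add: power_int_minus power_one_over inverse_eq_divide)

text \<open>Taking for \<open>g\<close> the identity with \<open>m = 0\<close>, or
  \<open>f_m_inv m\<close>, puts the integrand of \<open>Phi\<close> and the time-changed one into
  the same locale.\<close>

lemma step_blocks_powi:
  assumes b: "1 < b" and g: "\<And>j s. block_time m j < s \<Longrightarrow> s < block_time m (Suc j) \<Longrightarrow> \<lfloor>g s\<rfloor> = int j"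
  shows "step_blocks (\<lambda>t. b powi (- \<lfloor>g t\<rfloor>)) (block_time m) (\<lambda>j. (1 / b) ^ j)"
proof
  show "\<exists>n. t < block_time m n" for t
  proof -
    obtain n where "t < real n" using reals_Archimedean2 by blast
    then show ?thesis using block_time_ge[of n m] by (intro exI[of _ n]) simp
  qed
  show "(1 / b) ^ j \<noteq> (1 / b) ^ Suc j" for j using b by (simp add: field_simps)
  show "b powi (- \<lfloor>g s\<rfloor>) = (1 / b) ^ j" if "block_time m j < s" "s < block_time m (Suc j)" for j s
    by (rule powi_neg_floor[OF g[OF that]])
qed (rule block_time_0 block_time_less)+

lemma step_blocks_f_m_inv:
  "1 < b \<Longrightarrow> step_blocks (\<lambda>t. b powi (- \<lfloor>f_m_inv m t\<rfloor>)) (block_time m) (\<lambda>j. (1 / b) ^ j)"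
  by (rule step_blocks_powi) (auto intro: floor_f_m_inv)

lemma step_blocks_floor:
  "1 < b \<Longrightarrow> step_blocks (\<lambda>t. b powi (- \<lfloor>t\<rfloor>)) (block_time 0) (\<lambda>j. (1 / b) ^ j)"
  by (rule step_blocks_powi) (auto simp: block_time_def floor_eq_iff)

section \<open>Convergence of the integral over growing blocks\<close>

locale levy_blocks = levy_process M X + step_blocks f "block_time m" "\<lambda>j. (1 / b) ^ j"
  for M :: "'w measure" and X :: "real \<Rightarrow> 'w \<Rightarrow> real ^ 'd" and f :: "real \<Rightarrow> real" and m :: nat and b :: real +
  assumes b: "1 < b"
begin

definition block_inc :: "nat \<Rightarrow> 'w \<Rightarrow> real ^ 'd" where
  "block_inc j \<omega> = X (block_time m (Suc j)) \<omega> - X (block_time m j) \<omega>"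

lemma measurable_block_inc [measurable]: "block_inc j \<in> borel_measurable M"
  unfolding block_inc_def[abs_def] by (intro measurable_inc c_nonneg)

lemma law_block_inc: "law M (block_inc j) = nmul ((j + m) choose m) (inc_law 1)"
  using law_increment[of "block_time m j" "block_time m (Suc j)"] c_nonneg block_time_less[of m j]
  by (simp add: block_inc_def[abs_def] block_time_Suc inc_law_of_nat)

lemma indep_block_inc: "indep_vars (\<lambda>_. borel) block_inc {..<n}"
  unfolding block_inc_def[abs_def] by (rule indep_blocks) (simp_all add: block_time_0 block_time_less)

lemma step_integral_block_time:
  "step_integral X f (block_time m n) = (\<lambda>\<omega>. \<Sum>j<n. (1 / b) ^ j *\<^sub>R block_inc j \<omega>)"
  by (rule ext) (simp only: step_integral_c block_inc_def)

text \<open>The limit over real times is restricted to block ends, where the integral is a sum of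
  independent scaled block increments.\<close>

lemma law_tendsto_if_tendsto_in_prob:
  assumes "tendsto_in_prob M (step_integral X f) Y at_top"
  shows "law_tendsto (block_sum b m (inc_law 1)) (law M Y)"
proof -
  have [measurable]: "Y \<in> borel_measurable M" using assms by (simp add: tendsto_in_prob_def)
  have "law_tendsto (\<lambda>n. law M (step_integral X f (block_time m n))) (law M Y)"
  proof (rule law_tendsto_if_in_prob)
    show "step_integral X f (block_time m n) \<in> borel_measurable M" for n
      unfolding step_integral_block_time by measurable
    show "(\<lambda>n. prob {\<omega> \<in> space M. e < dist (step_integral X f (block_time m n) \<omega>) (Y \<omega>)}) \<longlonglongrightarrow> 0" if "0 < e" for e
      using assms that filterlim_compose[OF _ filterlim_c, of "\<lambda>t. prob {\<omega> \<in> space M. e < dist (step_integral X f t \<omega>) (Y \<omega>)}"]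
      by (simp add: tendsto_in_prob_def)
  qed simp
  also have "(\<lambda>n. law M (step_integral X f (block_time m n))) = block_sum b m (inc_law 1)"
    unfolding step_integral_block_time
    by (rule ext, rule law_block_sum) (simp_all add: law_block_inc indep_block_inc)
  finally show ?thesis .
qed

text \<open>The time \<open>s\<close> is split into complete unit steps and a fraction. There are at
  most \<open>Suc n ^ m\<close> unit steps, which \<open>tail_nmul_le_eventually\<close> handles
  uniformly; tightness over the unit interval handles the fraction.\<close>

lemma inc_within_block_eventually:
  assumes mom: "log_moment m (inc_law 1)" and e: "0 < e" "0 < \<eta>"
  shows "\<forall>\<^sub>F n in sequentially. \<forall>s. 0 \<le> s \<longrightarrow> s \<le> real ((n + m) choose m) \<longrightarrow> tail (inc_law s) (e * b ^ n) < \<eta>"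
proof -
  obtain K where K: "\<And>s. s \<in> {0..1} \<Longrightarrow> tail (inc_law s) K < \<eta> / 2"
    using inc_law_uniformly_tight[OF half_gt_zero[OF e(2)]] by blast
  have "\<forall>\<^sub>F n in sequentially. \<forall>N \<le> Suc n ^ m. tail (nmul N (inc_law 1)) (e / 2 * b ^ n) < \<eta> / 2"
    using e by (intro tail_nmul_le_eventually[OF mom b]) auto
  moreover have "\<forall>\<^sub>F n in sequentially. K \<le> e / 2 * b ^ n"
  proof -
    obtain N where N: "K / (e / 2) < b ^ N" using real_arch_pow[OF b] by blast
    have "K \<le> e / 2 * b ^ n" if "N \<le> n" for n
    proof -
      have "b ^ N \<le> b ^ n" using b that by (intro power_increasing) auto
      with N have "K / (e / 2) \<le> b ^ n" by linarith
      then show ?thesis using e by (simp add: field_simps)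
    qed
    then show ?thesis by (auto simp: eventually_sequentially)
  qed
  ultimately show ?thesis
  proof eventually_elim
    case (elim n)
    show ?case
    proof (intro allI impI)
      fix s assume s: "0 \<le> s" "s \<le> real ((n + m) choose m)"
      define k where "k = nat \<lfloor>s\<rfloor>"
      have sk: "real k \<le> s" "s - real k \<in> {0..1}" using s unfolding k_def by (auto; linarith)+
      then have "real k \<le> real ((n + m) choose m)" using s by linarith
      then have k: "k \<le> Suc n ^ m" using binomial_le_Suc_power[of n m] by linarith
      have "inc_law s = inc_law (real k + (s - real k))" by simp
      also have "\<dots> = nmul k (inc_law 1) + inc_law (s - real k)"
        using sk by (subst inc_law_add) (auto simp: inc_law_of_nat)
      finally have "tail (inc_law s) (e * b ^ n) \<le> tail (nmul k (inc_law 1)) (e / 2 * b ^ n) + tail (inc_law (s - real k)) (e / 2 * b ^ n)"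
        using tail_plus[of "nmul k (inc_law 1)" "inc_law (s - real k)" "e / 2 * b ^ n" "e / 2 * b ^ n"] by simp
      also have "tail (inc_law (s - real k)) (e / 2 * b ^ n) \<le> tail (inc_law (s - real k)) K"
        using elim(2) by (rule tail_antimono)
      finally show "tail (inc_law s) (e * b ^ n) < \<eta>" using K[OF sk(2)] elim(1) k by fastforce
    qed
  qed
qed

text \<open>At a time in block \<open>n\<close> the integral differs from the sum over the completed
  blocks by an increment scaled by \<open>(1 / b) ^ n\<close>. The sums converge by
  \<open>blocks_converge\<close>, and the increment is uniformly small by
  \<open>inc_within_block_eventually\<close>.\<close>

lemma tendsto_in_prob_if_log_moment:
  assumes mom: "log_moment (Suc m) (inc_law 1)"
  shows "tendsto_in_prob M (step_integral X f) (\<lambda>\<omega>. \<Sum>j. (1 / b) ^ j *\<^sub>R block_inc j \<omega>) at_top"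
proof -
  define S where "S n \<omega> = (\<Sum>j<n. (1 / b) ^ j *\<^sub>R block_inc j \<omega>)" for n \<omega>
  define Y where "Y \<omega> = (\<Sum>j. (1 / b) ^ j *\<^sub>R block_inc j \<omega>)" for \<omega>
  have [measurable]: "S n \<in> borel_measurable M" "Y \<in> borel_measurable M" for n
    unfolding S_def[abs_def] Y_def[abs_def] by measurable
  have "((\<lambda>t. prob {\<omega> \<in> space M. e < dist (step_integral X f t \<omega>) (Y \<omega>)}) \<longlongrightarrow> 0) at_top" if e: "0 < e" for e
  proof (rule tendstoI)
    fix \<eta> :: real assume \<eta>: "0 < \<eta>"
    have e2: "0 < e / 2" "0 < \<eta> / 2" using e \<eta> by auto
    have "(\<lambda>n. prob {\<omega> \<in> space M. e / 2 < dist (S n \<omega>) (Y \<omega>)}) \<longlonglongrightarrow> 0"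
      unfolding S_def Y_def by (rule blocks_converge[OF b measurable_block_inc law_block_inc mom e2(1)])
    then have "\<forall>\<^sub>F n in sequentially. prob {\<omega> \<in> space M. e / 2 < dist (S n \<omega>) (Y \<omega>)} < \<eta> / 2"
      using e2 by (intro order_tendstoD) 
    moreover note inc_within_block_eventually[OF log_moment_Suc_imp[OF mom] e2]
    ultimately have "\<forall>\<^sub>F n in sequentially. \<forall>t. block_time m n \<le> t \<longrightarrow> t < block_time m (Suc n) \<longrightarrow>
        prob {\<omega> \<in> space M. e < dist (step_integral X f t \<omega>) (Y \<omega>)} < \<eta>"
    proof eventually_elim
      case (elim n)
      show ?case
      proof (intro allI impI)
        fix t assume t: "block_time m n \<le> t" "t < block_time m (Suc n)"
        have t0: "0 \<le> block_time m n" "0 \<le> t" using c_nonneg[of n] t by auto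
        note [measurable] = measurable_X[OF t0(1)] measurable_X[OF t0(2)]
        have SI: "step_integral X f t \<omega> = S n \<omega> + (1 / b) ^ n *\<^sub>R (X t \<omega> - X (block_time m n) \<omega>)" for \<omega>
          unfolding S_def block_inc_def using t by (intro step_integral_eq) auto
        have "prob {\<omega> \<in> space M. e < dist (step_integral X f t \<omega>) (Y \<omega>)} \<le>
          prob ({\<omega> \<in> space M. e / 2 < dist (S n \<omega>) (Y \<omega>)} \<union> {\<omega> \<in> space M. e / 2 * b ^ n < norm (X t \<omega> - X (block_time m n) \<omega>)})"
        proof (rule finite_measure_mono)
          show "{\<omega> \<in> space M. e < dist (step_integral X f t \<omega>) (Y \<omega>)} \<subseteq>
            {\<omega> \<in> space M. e / 2 < dist (S n \<omega>) (Y \<omega>)} \<union> {\<omega> \<in> space M. e / 2 * b ^ n < norm (X t \<omega> - X (block_time m n) \<omega>)}"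
          proof
            fix \<omega> assume "\<omega> \<in> {\<omega> \<in> space M. e < dist (step_integral X f t \<omega>) (Y \<omega>)}"
            then have \<omega>: "\<omega> \<in> space M" "e < dist (step_integral X f t \<omega>) (Y \<omega>)" by auto
            have "dist (step_integral X f t \<omega>) (Y \<omega>) \<le> dist (S n \<omega>) (Y \<omega>) + norm ((1 / b) ^ n *\<^sub>R (X t \<omega> - X (block_time m n) \<omega>))"
              unfolding SI dist_norm
              using norm_triangle_ineq[of "S n \<omega> - Y \<omega>" "(1 / b) ^ n *\<^sub>R (X t \<omega> - X (block_time m n) \<omega>)"]
              by (simp add: algebra_simps)
            also have "norm ((1 / b) ^ n *\<^sub>R (X t \<omega> - X (block_time m n) \<omega>)) = norm (X t \<omega> - X (block_time m n) \<omega>) / b ^ n"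
              using b by (simp add: power_one_over)
            finally have "e / 2 < dist (S n \<omega>) (Y \<omega>) \<or> e / 2 < norm (X t \<omega> - X (block_time m n) \<omega>) / b ^ n"
              using \<omega> by linarith
            then show "\<omega> \<in> {\<omega> \<in> space M. e / 2 < dist (S n \<omega>) (Y \<omega>)} \<union> {\<omega> \<in> space M. e / 2 * b ^ n < norm (X t \<omega> - X (block_time m n) \<omega>)}"
              using \<omega> b by (auto simp: less_divide_eq)
          qed
        qed measurable
        also have "\<dots> \<le> prob {\<omega> \<in> space M. e / 2 < dist (S n \<omega>) (Y \<omega>)} + prob {\<omega> \<in> space M. e / 2 * b ^ n < norm (X t \<omega> - X (block_time m n) \<omega>)}"
          by (rule measure_Un_le) measurable
        also have "prob {\<omega> \<in> space M. e / 2 * b ^ n < norm (X t \<omega> - X (block_time m n) \<omega>)} = tail (inc_law (t - block_time m n)) (e / 2 * b ^ n)"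
          using tail_law[OF measurable_inc[OF t0]] law_increment[OF t0(1) t(1)] by simp
        also have "\<dots> < \<eta> / 2" using elim(2) t by (simp add: block_time_Suc)
        finally show "prob {\<omega> \<in> space M. e < dist (step_integral X f t \<omega>) (Y \<omega>)} < \<eta>"
          using elim(1) by simp
      qed
    qed
    then obtain N where N: "\<And>n t. N \<le> n \<Longrightarrow> block_time m n \<le> t \<Longrightarrow> t < block_time m (Suc n) \<Longrightarrow>
        prob {\<omega> \<in> space M. e < dist (step_integral X f t \<omega>) (Y \<omega>)} < \<eta>"
      by (auto simp: eventually_sequentially)
    \<comment> \<open>Eventuality in the block index becomes eventuality in time, since such a
      \<open>t\<close> lies in a block of index at least \<open>N\<close>.\<close>
    have "prob {\<omega> \<in> space M. e < dist (step_integral X f t \<omega>) (Y \<omega>)} < \<eta>" if t: "block_time m N \<le> t" for t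
    proof -
      have "0 \<le> t" using t c_nonneg[of N] by simp
      then obtain n where n: "block_time m n \<le> t" "t < block_time m (Suc n)" by (rule block_exists)
      have "block_time m N < block_time m (Suc n)" using t n by simp
      then have "N \<le> n" by (simp add: c_less_iff)
      then show ?thesis using n by (rule N)
    qed
    then show "\<forall>\<^sub>F t in at_top. dist (prob {\<omega> \<in> space M. e < dist (step_integral X f t \<omega>) (Y \<omega>)}) 0 < \<eta>"
      by (auto simp: eventually_at_top_linorder)
  qed
  then show ?thesis by (simp add: tendsto_in_prob_def Y_def[symmetric, abs_def])
qed

lemma definable_if_log_moment: "log_moment (Suc m) (inc_law 1) \<Longrightarrow> definable M X f"
  using tendsto_in_prob_if_log_moment step_function by (auto simp: definable_def)

lemma integral_law_tendsto:
  assumes "definable M X f"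
  obtains \<rho> where "integral_law M X f = meas \<rho>" "law_tendsto (block_sum b m (inc_law 1)) \<rho>"
proof -
  define Y where "Y = improper_integral M X f"
  have "\<exists>Y. tendsto_in_prob M (step_integral X f) Y at_top" using assms by (simp add: definable_def)
  then have Y: "tendsto_in_prob M (step_integral X f) Y at_top"
    unfolding Y_def improper_integral_def by (rule someI_ex)
  then have "Y \<in> borel_measurable M" by (simp add: tendsto_in_prob_def)
  then have "integral_law M X f = meas (law M Y)"
    by (simp add: integral_law_def Y_def meas_law)
  then show ?thesis using law_tendsto_if_tendsto_in_prob[OF Y] by (rule that)
qed

end

section \<open>The iterates of the mapping\<close>

lemma levy_family_blocks:
  assumes "levy_family P X" "inf_div_law A" "1 < b"
    and "step_blocks f (block_time m) (\<lambda>j. (1 / b) ^ j)"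
  shows "levy_blocks (P (meas A)) (X (meas A)) f m b" "levy_process.inc_law (P (meas A)) (X (meas A)) 1 = A"
proof -
  have A: "meas A \<in> inf_div" using assms(2) by (simp add: meas_in_inf_div_iff)
  then have levy: "levy_process (P (meas A)) (X (meas A))"
    and distr: "distr (P (meas A)) borel (X (meas A) 1) = meas A"
    using assms(1) by (auto simp: levy_family_def)
  show "levy_blocks (P (meas A)) (X (meas A)) f m b"
    by (intro levy_blocks.intro levy_blocks_axioms.intro levy assms(3,4))
  show "levy_process.inc_law (P (meas A)) (X (meas A)) 1 = A"
    using levy_process.meas_inc_law_1[OF levy] distr by (simp add: meas_inject)
qed

context
  fixes P :: "(real ^ 'd) measure \<Rightarrow> 'w measure"
    and X :: "(real ^ 'd) measure \<Rightarrow> real \<Rightarrow> 'w \<Rightarrow> real ^ 'd"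
    and b :: real
  assumes levy: "levy_family P X" and b: "1 < b"
begin

text \<open>Definability produces a limit law of the block sums, hence a fixed point; the order 1
  moment then follows from \<open>log_moment_Suc_if_fixpoint\<close> started at the trivial order
  0.\<close>

lemma Phi_if_definable:
  assumes "inf_div_law A" "definable (P (meas A)) (X (meas A)) (\<lambda>t. b powi (- \<lfloor>t\<rfloor>))"
  shows "log_moment (Suc 0) A" "Phi P X b (meas A) = meas (phi_law b A)"
proof -
  note blocks = levy_family_blocks[OF levy assms(1) b step_blocks_floor[OF b]]
  obtain \<rho> where \<rho>: "integral_law (P (meas A)) (X (meas A)) (\<lambda>t. b powi (- \<lfloor>t\<rfloor>)) = meas \<rho>"
    and lim: "law_tendsto (block_sum b 0 A) \<rho>"
    using levy_blocks.integral_law_tendsto[OF blocks(1) assms(2)] unfolding blocks(2) by blast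
  have fix_\<rho>: "\<rho> = A + lscale (1 / b) \<rho>"
    using lim by (rule fixpoint_iff_block_sum_tendsto[OF b, THEN iffD2])
  show "log_moment (Suc 0) A"
    by (rule log_moment_Suc_if_fixpoint[OF fix_\<rho> b log_moment_0])
  show "Phi P X b (meas A) = meas (phi_law b A)"
    unfolding Phi_def \<rho> phi_law_eqI[OF b fix_\<rho>] ..
qed

lemma meas_in_Phi_dom_iff:
  assumes "inf_div_law A"
  shows "meas A \<in> Phi_dom P X b \<longleftrightarrow> log_moment (Suc 0) A"
proof
  assume "meas A \<in> Phi_dom P X b"
  then show "log_moment (Suc 0) A"
    using Phi_if_definable(1)[OF assms] by (simp add: Phi_dom_def)
next
  note blocks = levy_family_blocks[OF levy assms b step_blocks_floor[OF b]]
  assume "log_moment (Suc 0) A"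
  then show "meas A \<in> Phi_dom P X b"
    using levy_blocks.definable_if_log_moment[OF blocks(1)] blocks(2) assms
    by (simp add: Phi_dom_def meas_in_inf_div_iff)
qed

lemma Phi_meas:
  assumes "inf_div_law A" "log_moment (Suc 0) A"
  shows "Phi P X b (meas A) = meas (phi_law b A)"
  using meas_in_Phi_dom_iff[OF assms(1)] assms(2)
  by (intro Phi_if_definable(2)[OF assms(1)]) (simp add: Phi_dom_def)

text \<open>The three claims support each other: applying \<open>Phi\<close> once more requires that
  the current iterate be infinitely divisible with a moment of order 1, and the shift of orders in
  the third claim traces that moment back to \<open>A\<close>.\<close>

lemma phi_law_funpow:
  assumes "inf_div_law A" "log_moment k A"
  shows "(Phi P X b ^^ k) (meas A) = meas ((phi_law b ^^ k) A)"
    and "inf_div_law ((phi_law b ^^ k) A)"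
    and "log_moment i ((phi_law b ^^ k) A) \<longleftrightarrow> log_moment (k + i) A"
  using assms(2)
proof (induction k arbitrary: i)
  case (Suc k)
  {
    case 1
    note IH = Suc.IH[OF log_moment_Suc_imp[OF 1]]
    have "log_moment (Suc 0) ((phi_law b ^^ k) A)" using IH(3)[of "Suc 0"] 1 by simp
    then show ?case using IH(1,2) by (simp add: Phi_meas)
  next
    case 2
    note IH = Suc.IH[OF log_moment_Suc_imp[OF 2]]
    have "log_moment (Suc 0) ((phi_law b ^^ k) A)" using IH(3)[of "Suc 0"] 2 by simp
    then show ?case using IH(2) by (simp add: inf_div_law_phi_law[OF b])
  next
    case 3
    note IH = Suc.IH[OF log_moment_Suc_imp[OF 3]]
    have "log_moment (Suc 0) ((phi_law b ^^ k) A)" using IH(3)[of "Suc 0"] 3 by simp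
    then have "log_moment i (phi_law b ((phi_law b ^^ k) A)) \<longleftrightarrow> log_moment (Suc i) ((phi_law b ^^ k) A)"
      by (intro log_moment_fixpoint_iff[OF phi_law_fixpoint[OF b] b])
    then show ?case using IH(3)[of "Suc i"] by simp
  }
qed (use assms(1) in simp_all)

lemma meas_in_Phi_pow_dom_iff:
  assumes "inf_div_law A"
  shows "meas A \<in> Phi_pow_dom P X b k \<longleftrightarrow> log_moment k A"
proof (induction k)
  case 0
  show ?case using assms by (simp add: meas_in_inf_div_iff log_moment_0)
next
  case (Suc k)
  have "(Phi P X b ^^ k) (meas A) \<in> Phi_dom P X b \<longleftrightarrow> log_moment (Suc k) A" if "log_moment k A"
    using phi_law_funpow[OF assms that] meas_in_Phi_dom_iff by simp
  then show ?case
    using Suc assms log_moment_Suc_imp[of k A] by (auto simp: meas_in_inf_div_iff)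
qed

lemma Phi_pow_dom_eq: "Phi_pow_dom P X b k = inf_div_log k"
proof (rule set_eqI)
  fix \<mu> :: "(real ^ 'd) measure"
  show "\<mu> \<in> Phi_pow_dom P X b k \<longleftrightarrow> \<mu> \<in> inf_div_log k"
  proof (cases "\<mu> \<in> inf_div")
    case True
    then have "\<mu> = meas (Law \<mu>)" by (simp add: inf_div_def is_distribution_Law)
    then show ?thesis
      using True meas_in_Phi_pow_dom_iff[of "Law \<mu>" k] meas_in_inf_div_log_iff[of "Law \<mu>" k]
        meas_in_inf_div_iff[of "Law \<mu>"] by simp
  next
    case False
    then show ?thesis by (cases k) (auto simp: inf_div_log_def)
  qed
qed

text \<open>The iterate and the time-changed integral are both identified with the limit law of
  \<open>block_sum b m A\<close>, and weak limits are unique.\<close>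

lemma Phi_funpow_eq_integral_law:
  assumes "\<mu> \<in> inf_div_log (Suc m)"
  shows "definable (P \<mu>) (X \<mu>) (\<lambda>t. b powi (- \<lfloor>f_m_inv m t\<rfloor>))"
    and "(Phi P X b ^^ Suc m) \<mu> = integral_law (P \<mu>) (X \<mu>) (\<lambda>t. b powi (- \<lfloor>f_m_inv m t\<rfloor>))"
proof -
  define A where "A = Law \<mu>"
  have \<mu>: "\<mu> = meas A"
    using assms by (simp add: A_def inf_div_log_def inf_div_def is_distribution_Law)
  have A: "inf_div_law A" "log_moment (Suc m) A"
    using assms unfolding \<mu> meas_in_inf_div_log_iff by auto
  note blocks = levy_family_blocks[OF levy A(1) b step_blocks_f_m_inv[OF b, of m]]
  show def: "definable (P \<mu>) (X \<mu>) (\<lambda>t. b powi (- \<lfloor>f_m_inv m t\<rfloor>))"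
    unfolding \<mu> using A(2) by (intro levy_blocks.definable_if_log_moment[OF blocks(1)]) (simp add: blocks(2))
  obtain \<rho> where \<rho>: "integral_law (P (meas A)) (X (meas A)) (\<lambda>t. b powi (- \<lfloor>f_m_inv m t\<rfloor>)) = meas \<rho>"
    and lim: "law_tendsto (block_sum b m A) \<rho>"
    using levy_blocks.integral_law_tendsto[OF blocks(1) def[unfolded \<mu>]] unfolding blocks(2) by blast
  have "\<rho> = (phi_law b ^^ Suc m) A"
    using law_tendsto_unique[OF lim block_sum_tendsto_phi_law[OF b A(2)]] .
  then show "(Phi P X b ^^ Suc m) \<mu> = integral_law (P \<mu>) (X \<mu>) (\<lambda>t. b powi (- \<lfloor>f_m_inv m t\<rfloor>))"
    unfolding \<mu> \<rho> using phi_law_funpow(1)[OF A] by simp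
qed

end

theorem theorem7p1:
  fixes P :: "(real ^ 'd) measure \<Rightarrow> 'w measure"
    and X :: "(real ^ 'd) measure \<Rightarrow> real \<Rightarrow> 'w \<Rightarrow> real ^ 'd"
    and b :: real and m :: nat
  assumes "levy_family P X"
    and "b > 1"
  shows "Phi_pow_dom P X b (m + 1) = inf_div_log (m + 1) \<and>
    (\<forall>\<mu> \<in> inf_div_log (m + 1).
       definable (P \<mu>) (X \<mu>) (\<lambda>t. b powi (- \<lfloor>f_m_inv m t\<rfloor>)) \<and>
       (Phi P X b ^^ (m + 1)) \<mu> = integral_law (P \<mu>) (X \<mu>) (\<lambda>t. b powi (- \<lfloor>f_m_inv m t\<rfloor>)))"
  unfolding Suc_eq_plus1[symmetric]
  by (intro conjI ballI Phi_pow_dom_eq Phi_funpow_eq_integral_law assms)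

end
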